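(* Let $(\otimes,\mathrm{hom}_\ell,\mathrm{hom}_r)\colon\mathcal K\times\mathcal M\to\mathcal N$ be a two-variable adjunction, where $\mathcal K,\mathcal M$ have pullbacks and $\mathcal N$ has pushouts; let $(\mathbb C,\mathbb F)$ be an awfs on $\mathcal M$ and $(\mathbb L,\mathbb R)$ an awfs on $\mathcal N$; and let $i\colon A\to B$ be an arrow of $\mathcal K$. Write $X^B=\mathrm{hom}_\ell(B,X)$ and $\widehat{\mathrm{hom}}=\widehat{\mathrm{hom}}_\ell$. A functor $\mathbb R\text{-}\mathbf{alg}\to\mathbb F\text{-}\mathbf{alg}$ lifting $\widehat{\mathrm{hom}}(i,-)\colon\mathcal N^{\mathbf 2}\to\mathcal M^{\mathbf 2}$ defines a lax morphism of awfs $(\mathbb L,\mathbb R)\to(\mathbb C,\mathbb F)$ if and only if the following holds for every composable pair of $\mathbb R$-algebras $f\colon X\to Y$, $g\colon Y\to Z$, every $\mathbb C$-coalgebra $j\colon J\to K$, and every lifting problem $(a,b\times c)\colon j\Rightarrow\widehat{\mathrm{hom}}(i,gf)$, with $a\colon J\to X^B$, $b\times c\colon K\to Z^B\times_{Z^A}X^A$: let $d\colon K\to Y^B$ be the chosen solution to the lifting problem $(f^B a,\ b\times(f^A c))\colon j\Rightarrow\widehat{\mathrm{hom}}(i,g)$ obtained by composing with the square $(f^B,1\times f^A)\colon\widehat{\mathrm{hom}}(i,gf)\Rightarrow\widehat{\mathrm{hom}}(i,g)$; let $e\colon K\to X^B$ be the chosen solution to the resulting lifting problem $(a,d\times c)\colon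 j\Rightarrow\widehat{\mathrm{hom}}(i,f)$; then $e$ is the chosen solution to the original lifting problem $(a,b\times c)\colon j\Rightarrow\widehat{\mathrm{hom}}(i,gf)$. Here $gf$ carries the composite $\mathbb R$-algebra structure, $\widehat{\mathrm{hom}}(i,f)$, $\widehat{\mathrm{hom}}(i,g)$, $\widehat{\mathrm{hom}}(i,gf)$ carry the $\mathbb F$-algebra structures assigned by the lifted functor, and chosen solutions are the canonical solutions of lifting problems of $\mathbb C$-coalgebras against $\mathbb F$-algebras.
   Context: $\mathcal M^{\mathbf 2}$ is the arrow category of $\mathcal M$; a morphism $(u,v)\colon f\Rightarrow g$ is a commutative square $gu=vf$, also called a lifting problem of $f$ against $g$. A functorial factorization $\vec E=(L,R)$ factors each arrow functorially as $f=Rf\cdot Lf$ with $Lf\colon\mathrm{dom}f\to Ef$, $Rf\colon Ef\to\mathrm{cod}f$, $E\colon\mathcal M^{\mathbf 2}\to\mathcal M$ a functor; there are canonical transformations $\vec\epsilon_f=(1,Rf)\colon Lf\Rightarrow f$ and $\vec\eta_f=(Lf,1)\colon f\Rightarrow Rf$. An algebraic weak factorization system (awfs) $(\mathbb L,\mathbb R)$ is a comonad $\mathbb L=(L,\vec\epsilon,\vec\delta)$ and a monad $\mathbb R=(R,\vec\eta,\vec\mu)$ on the arrow category arising from a functorial factorization, with $\vec\delta_f=(1,\delta_f)$, $\delta_f\colon Ef\to ELf$, $\vec\mu_f=(\mu_f,1)$, $\mu_f\colon ERf\to Ef$, such that $(\delta,\mu)\colon LR\Rightarrow RL$ is a distributive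 law. An $\mathbb L$-coalgebra is $(j,s)$, $s\colon\mathrm{cod}j\to Ej$, with $sj=Lj$, $Rj\cdot s=1$, $\delta_j s=E(1,s)s$; an $\mathbb R$-algebra is $(f,r)$, $r\colon Ef\to\mathrm{dom}f$, with $r\cdot Lf=1$, $fr=Rf$, $r\mu_f=r\,E(r,1)$. The canonical (chosen) solution to $(u,v)\colon j\Rightarrow f$ is $r\cdot E(u,v)\cdot s$. The composite of $\mathbb R$-algebras $(f,s),(g,t)$ with $\mathrm{cod}f=\mathrm{dom}g$ is $gf$ with structure $t\bullet s=s\cdot E(1,t\cdot E(f,1))\cdot\delta_{gf}$. A lifted functor is one commuting with the forgetful functors to arrow categories. The functorial factorization of $(\mathbb C,\mathbb F)$ is written $f=Ff\cdot Cf$ through $Qf$; that of $(\mathbb L,\mathbb R)$ is $f=Rf\cdot Lf$ through $Ef$. A two-variable adjunction consists of bifunctors $\otimes\colon\mathcal K\times\mathcal M\to\mathcal N$, $\mathrm{hom}_\ell\colon\mathcal K^{\mathrm{op}}\times\mathcal N\to\mathcal M$, $\mathrm{hom}_r\colon\mathcal M^{\mathrm{op}}\times\mathcal N\to\mathcal K$ with natural isomorphisms $\mathcal N(k\otimes m,n)\cong\mathcal M(m,\mathrm{hom}_\ell(k,n))\cong\mathcal K(k,\mathrm{hom}_r(m,n))$. For $i\colon A\to B$ in $\mathcal K$ and $f\colon X\to Y$ in $\mathcal N$, $\widehat{\mathrm{hom}}_\ell(i,f)\colon X^B\to Y^B\times_{Y^A}X^A$ is the induced map into the pullback; $b\times c$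 denotes the map to such a pullback with components $b,c$. A lifted functor $\mathbb R\text{-}\mathbf{alg}\to\mathbb F\text{-}\mathbf{alg}$ of $\widehat{\mathrm{hom}}(i,-)$ corresponds to a characterizing natural transformation $\rho_f\colon Q\widehat{\mathrm{hom}}(i,f)\to Ef^B$: given $\rho$, an algebra $(f,r)$ is sent to $\widehat{\mathrm{hom}}(i,f)$ with structure $r^B\cdot\rho_f$; given the lifted functor, $\rho_f$ is $Q\widehat{\mathrm{hom}}(i,\vec\eta_f)\colon Q\widehat{\mathrm{hom}}(i,f)\to Q\widehat{\mathrm{hom}}(i,Rf)$ followed by the algebra structure assigned to $\widehat{\mathrm{hom}}(i,(Rf,\mu_f))$. The lifted functor defines a lax morphism of awfs if $\rho$ satisfies: (1) $\rho_f\cdot C\widehat{\mathrm{hom}}(i,f)=(Lf)^B$ and $\widehat{\mathrm{hom}}(i,Rf)\cdot\rho_f=(1\times(Lf)^A)\cdot F\widehat{\mathrm{hom}}(i,f)$; (2) with $\vec\rho_f=(\rho_f,1\times(Lf)^A)\colon F\widehat{\mathrm{hom}}(i,f)\Rightarrow\widehat{\mathrm{hom}}(i,Rf)$, one has $\vec\rho_f\cdot\vec\mu_{\widehat{\mathrm{hom}}(i,f)}=\widehat{\mathrm{hom}}(i,\vec\mu_f)\cdot\vec\rho_{Rf}\cdot F\vec\rho_f$; (3) with $\rho'_f\colon Q\widehat{\mathrm{hom}}(i,f)\to Ef^B\times_{Ef^A}X^A$ the map with components $\rho_f$ and the $X^A$-component of $F\widehat{\mathrm{hom}}(i,f)$,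 and $\vec\rho\,'_f=(1,\rho'_f)\colon C\widehat{\mathrm{hom}}(i,f)\Rightarrow\widehat{\mathrm{hom}}(i,Lf)$, one has $\widehat{\mathrm{hom}}(i,\vec\delta_f)\cdot\vec\rho\,'_f=\vec\rho\,'_{Lf}\cdot C\vec\rho\,'_f\cdot\vec\delta_{\widehat{\mathrm{hom}}(i,f)}$. (Conditions (1), (2) hold for every lifted functor.) *)

theory Defs
  imports Main
begin

section \<open>Categories, functors, natural transformations\<close>

record ('o, 'a) cat =
  Obj :: "'o set"
  Arr :: "'a set"
  Dom :: "'a \<Rightarrow> 'o"
  Cod :: "'a \<Rightarrow> 'o"
  Ident :: "'o \<Rightarrow> 'a"
  Comp :: "'a \<Rightarrow> 'a \<Rightarrow> 'a" (infixl "\<cdot>\<index>" 70)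

definition Hom :: "('o, 'a) cat \<Rightarrow> 'o \<Rightarrow> 'o \<Rightarrow> 'a set" where
  "Hom C x y = {f \<in> Arr C. Dom C f = x \<and> Cod C f = y}"

locale category =
  fixes C :: "('o, 'a) cat"
  assumes dom_obj: "f \<in> Arr C \<Longrightarrow> Dom C f \<in> Obj C"
    and cod_obj: "f \<in> Arr C \<Longrightarrow> Cod C f \<in> Obj C"
    and ident_hom: "x \<in> Obj C \<Longrightarrow> Ident C x \<in> Hom C x x"
    and comp_hom: "\<lbrakk>f \<in> Hom C x y; g \<in> Hom C y z\<rbrakk> \<Longrightarrow> g \<cdot>\<^bsub>C\<^esub> f \<in> Hom C x z"
    and ident_left: "f \<in> Hom C x y \<Longrightarrow> Ident C y \<cdot>\<^bsub>C\<^esub> f = f"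
    and ident_right: "f \<in> Hom C x y \<Longrightarrow> f \<cdot>\<^bsub>C\<^esub> Ident C x = f"
    and comp_assoc: "\<lbrakk>f \<in> Hom C w x; g \<in> Hom C x y; h \<in> Hom C y z\<rbrakk>
      \<Longrightarrow> (h \<cdot>\<^bsub>C\<^esub> g) \<cdot>\<^bsub>C\<^esub> f = h \<cdot>\<^bsub>C\<^esub> (g \<cdot>\<^bsub>C\<^esub> f)"

definition op_cat :: "('o, 'a) cat \<Rightarrow> ('o, 'a) cat" where
  "op_cat C = \<lparr>Obj = Obj C, Arr = Arr C, Dom = Cod C, Cod = Dom C, Ident = Ident C,
    Comp = (\<lambda>g f. f \<cdot>\<^bsub>C\<^esub> g)\<rparr>"

definition prod_cat :: "('o, 'a) cat \<Rightarrow> ('p, 'b) cat \<Rightarrow> ('o \<times> 'p, 'a \<times> 'b) cat" where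
  "prod_cat C D = \<lparr>Obj = Obj C \<times> Obj D, Arr = Arr C \<times> Arr D,
    Dom = (\<lambda>(f, g). (Dom C f, Dom D g)), Cod = (\<lambda>(f, g). (Cod C f, Cod D g)),
    Ident = (\<lambda>(x, y). (Ident C x, Ident D y)),
    Comp = (\<lambda>(f', g') (f, g). (f' \<cdot>\<^bsub>C\<^esub> f, g' \<cdot>\<^bsub>D\<^esub> g))\<rparr>"

record ('o, 'a, 'p, 'b) fun_data =
  on_obj :: "'o \<Rightarrow> 'p"
  on_arr :: "'a \<Rightarrow> 'b"

definition is_functor ::
  "('o, 'a) cat \<Rightarrow> ('p, 'b) cat \<Rightarrow> ('o, 'a, 'p, 'b) fun_data \<Rightarrow> bool" where
  "is_functor C D F \<longleftrightarrow>
    category C \<and> category D \<and>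
    (\<forall>x\<in>Obj C. on_obj F x \<in> Obj D) \<and>
    (\<forall>f\<in>Arr C. on_arr F f \<in> Hom D (on_obj F (Dom C f)) (on_obj F (Cod C f))) \<and>
    (\<forall>x\<in>Obj C. on_arr F (Ident C x) = Ident D (on_obj F x)) \<and>
    (\<forall>f\<in>Arr C. \<forall>g\<in>Arr C. Cod C f = Dom C g \<longrightarrow>
       on_arr F (g \<cdot>\<^bsub>C\<^esub> f) = on_arr F g \<cdot>\<^bsub>D\<^esub> on_arr F f)"

definition id_fun :: "('o, 'a, 'o, 'a) fun_data" where
  "id_fun = \<lparr>on_obj = (\<lambda>x. x), on_arr = (\<lambda>f. f)\<rparr>"

definition comp_fun ::
  "('p, 'b, 'q, 'c) fun_data \<Rightarrow> ('o, 'a, 'p, 'b) fun_data \<Rightarrow> ('o, 'a, 'q, 'c) fun_data"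
  (infixl "\<odot>" 75) where
  "G \<odot> F = \<lparr>on_obj = (\<lambda>x. on_obj G (on_obj F x)), on_arr = (\<lambda>f. on_arr G (on_arr F f))\<rparr>"

definition nat_trans ::
  "('o, 'a) cat \<Rightarrow> ('p, 'b) cat \<Rightarrow> ('o, 'a, 'p, 'b) fun_data \<Rightarrow> ('o, 'a, 'p, 'b) fun_data
    \<Rightarrow> ('o \<Rightarrow> 'b) \<Rightarrow> bool" where
  "nat_trans C D F G \<tau> \<longleftrightarrow>
    is_functor C D F \<and> is_functor C D G \<and>
    (\<forall>x\<in>Obj C. \<tau> x \<in> Hom D (on_obj F x) (on_obj G x)) \<and>
    (\<forall>f\<in>Arr C. \<tau> (Cod C f) \<cdot>\<^bsub>D\<^esub> on_arr F f = on_arr G f \<cdot>\<^bsub>D\<^esub> \<tau> (Dom C f))"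

section \<open>Monads, comonads, distributive laws\<close>

definition is_monad ::
  "('o, 'a) cat \<Rightarrow> ('o, 'a, 'o, 'a) fun_data \<Rightarrow> ('o \<Rightarrow> 'a) \<Rightarrow> ('o \<Rightarrow> 'a) \<Rightarrow> bool" where
  "is_monad C T \<eta> \<mu> \<longleftrightarrow>
    nat_trans C C id_fun T \<eta> \<and> nat_trans C C (T \<odot> T) T \<mu> \<and>
    (\<forall>x\<in>Obj C. \<mu> x \<cdot>\<^bsub>C\<^esub> \<eta> (on_obj T x) = Ident C (on_obj T x) \<and>
               \<mu> x \<cdot>\<^bsub>C\<^esub> on_arr T (\<eta> x) = Ident C (on_obj T x) \<and>
               \<mu> x \<cdot>\<^bsub>C\<^esub> \<mu> (on_obj T x) = \<mu> x \<cdot>\<^bsub>C\<^esub> on_arr T (\<mu> x))"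

definition is_comonad ::
  "('o, 'a) cat \<Rightarrow> ('o, 'a, 'o, 'a) fun_data \<Rightarrow> ('o \<Rightarrow> 'a) \<Rightarrow> ('o \<Rightarrow> 'a) \<Rightarrow> bool" where
  "is_comonad C G \<epsilon> \<delta> \<longleftrightarrow>
    nat_trans C C G id_fun \<epsilon> \<and> nat_trans C C G (G \<odot> G) \<delta> \<and>
    (\<forall>x\<in>Obj C. \<epsilon> (on_obj G x) \<cdot>\<^bsub>C\<^esub> \<delta> x = Ident C (on_obj G x) \<and>
               on_arr G (\<epsilon> x) \<cdot>\<^bsub>C\<^esub> \<delta> x = Ident C (on_obj G x) \<and>
               \<delta> (on_obj G x) \<cdot>\<^bsub>C\<^esub> \<delta> x = on_arr G (\<delta> x) \<cdot>\<^bsub>C\<^esub> \<delta> x)"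

text \<open>Distributive law \<open>\<lambda> : GT \<Rightarrow> TG\<close> of a comonad \<open>(G, \<epsilon>, \<delta>)\<close> over a monad \<open>(T, \<eta>, \<mu>)\<close>:
  compatibility with the unit, multiplication, counit and comultiplication, in this order.\<close>

definition distributive_law ::
  "('o, 'a) cat \<Rightarrow> ('o, 'a, 'o, 'a) fun_data \<Rightarrow> ('o \<Rightarrow> 'a) \<Rightarrow> ('o \<Rightarrow> 'a)
    \<Rightarrow> ('o, 'a, 'o, 'a) fun_data \<Rightarrow> ('o \<Rightarrow> 'a) \<Rightarrow> ('o \<Rightarrow> 'a) \<Rightarrow> ('o \<Rightarrow> 'a) \<Rightarrow> bool" where
  "distributive_law C G \<epsilon> \<delta> T \<eta> \<mu> l \<longleftrightarrow>
    nat_trans C C (G \<odot> T) (T \<odot> G) l \<and>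
    (\<forall>x\<in>Obj C.
      l x \<cdot>\<^bsub>C\<^esub> on_arr G (\<eta> x) = \<eta> (on_obj G x) \<and>
      l x \<cdot>\<^bsub>C\<^esub> on_arr G (\<mu> x) = \<mu> (on_obj G x) \<cdot>\<^bsub>C\<^esub> on_arr T (l x) \<cdot>\<^bsub>C\<^esub> l (on_obj T x) \<and>
      on_arr T (\<epsilon> x) \<cdot>\<^bsub>C\<^esub> l x = \<epsilon> (on_obj T x) \<and>
      on_arr T (\<delta> x) \<cdot>\<^bsub>C\<^esub> l x = l (on_obj G x) \<cdot>\<^bsub>C\<^esub> on_arr G (l x) \<cdot>\<^bsub>C\<^esub> \<delta> (on_obj T x))"

section \<open>Pullbacks and pushouts\<close>

definition is_pullback :: "('o, 'a) cat \<Rightarrow> 'a \<Rightarrow> 'a \<Rightarrow> 'a \<Rightarrow> 'a \<Rightarrow> bool" where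
  "is_pullback C f g p q \<longleftrightarrow>
    f \<in> Arr C \<and> g \<in> Arr C \<and> Cod C f = Cod C g \<and>
    p \<in> Arr C \<and> q \<in> Arr C \<and> Dom C p = Dom C q \<and> Cod C p = Dom C f \<and> Cod C q = Dom C g \<and>
    f \<cdot>\<^bsub>C\<^esub> p = g \<cdot>\<^bsub>C\<^esub> q \<and>
    (\<forall>w\<in>Obj C. \<forall>b\<in>Hom C w (Dom C f). \<forall>c\<in>Hom C w (Dom C g). f \<cdot>\<^bsub>C\<^esub> b = g \<cdot>\<^bsub>C\<^esub> c \<longrightarrow>
      (\<exists>!h. h \<in> Hom C w (Dom C p) \<and> p \<cdot>\<^bsub>C\<^esub> h = b \<and> q \<cdot>\<^bsub>C\<^esub> h = c))"

definition has_pullbacks :: "('o, 'a) cat \<Rightarrow> bool" where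
  "has_pullbacks C \<longleftrightarrow>
    (\<forall>f\<in>Arr C. \<forall>g\<in>Arr C. Cod C f = Cod C g \<longrightarrow> (\<exists>p q. is_pullback C f g p q))"

definition has_pushouts :: "('o, 'a) cat \<Rightarrow> bool" where
  "has_pushouts C \<longleftrightarrow> has_pullbacks (op_cat C)"

text \<open>\<open>pb\<close> assigns to every cospan \<open>(f, g)\<close> the two projections of a chosen pullback.\<close>

definition pullback_choice :: "('o, 'a) cat \<Rightarrow> ('a \<Rightarrow> 'a \<Rightarrow> 'a \<times> 'a) \<Rightarrow> bool" where
  "pullback_choice C pb \<longleftrightarrow>
    (\<forall>f\<in>Arr C. \<forall>g\<in>Arr C. Cod C f = Cod C g \<longrightarrow>
      is_pullback C f g (fst (pb f g)) (snd (pb f g)))"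

section \<open>Two-variable adjunctions\<close>

definition two_variable_adjunction ::
  "('ok, 'ak) cat \<Rightarrow> ('om, 'am) cat \<Rightarrow> ('on, 'an) cat
    \<Rightarrow> ('ok \<times> 'om, 'ak \<times> 'am, 'on, 'an) fun_data
    \<Rightarrow> ('ok \<times> 'on, 'ak \<times> 'an, 'om, 'am) fun_data
    \<Rightarrow> ('om \<times> 'on, 'am \<times> 'an, 'ok, 'ak) fun_data
    \<Rightarrow> ('ok \<Rightarrow> 'om \<Rightarrow> 'on \<Rightarrow> 'an \<Rightarrow> 'am) \<Rightarrow> ('ok \<Rightarrow> 'om \<Rightarrow> 'on \<Rightarrow> 'am \<Rightarrow> 'ak) \<Rightarrow> bool" where
  "two_variable_adjunction K M N T Hl Hr \<phi> \<psi> \<longleftrightarrow>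
    is_functor (prod_cat K M) N T \<and>
    is_functor (prod_cat (op_cat K) N) M Hl \<and>
    is_functor (prod_cat (op_cat M) N) K Hr \<and>
    category K \<and> category M \<and> category N \<and>
    (\<forall>k\<in>Obj K. \<forall>m\<in>Obj M. \<forall>n\<in>Obj N.
      bij_betw (\<phi> k m n) (Hom N (on_obj T (k, m)) n) (Hom M m (on_obj Hl (k, n))) \<and>
      bij_betw (\<psi> k m n) (Hom M m (on_obj Hl (k, n))) (Hom K k (on_obj Hr (m, n)))) \<and>
    (\<forall>x\<in>Arr K. \<forall>y\<in>Arr M. \<forall>z\<in>Arr N.
      (\<forall>t\<in>Hom N (on_obj T (Cod K x, Cod M y)) (Dom N z).
        \<phi> (Dom K x) (Dom M y) (Cod N z) (z \<cdot>\<^bsub>N\<^esub> t \<cdot>\<^bsub>N\<^esub> on_arr T (x, y)) =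
        on_arr Hl (x, z) \<cdot>\<^bsub>M\<^esub> \<phi> (Cod K x) (Cod M y) (Dom N z) t \<cdot>\<^bsub>M\<^esub> y) \<and>
      (\<forall>t\<in>Hom M (Cod M y) (on_obj Hl (Cod K x, Dom N z)).
        \<psi> (Dom K x) (Dom M y) (Cod N z) (on_arr Hl (x, z) \<cdot>\<^bsub>M\<^esub> t \<cdot>\<^bsub>M\<^esub> y) =
        on_arr Hr (y, z) \<cdot>\<^bsub>K\<^esub> \<psi> (Cod K x) (Cod M y) (Dom N z) t \<cdot>\<^bsub>K\<^esub> x))"

section \<open>The arrow category\<close>

text \<open>\<open>Square f u v g\<close> is \<open>(u, v) : f \<Rightarrow> g\<close>, with \<open>g u = v f\<close>.\<close>

datatype 'a square = Square (sq_dom: 'a) (sq_top: 'a) (sq_bot: 'a) (sq_cod: 'a)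

definition arrow_cat :: "('o, 'a) cat \<Rightarrow> ('a, 'a square) cat" where
  "arrow_cat C = \<lparr>Obj = Arr C,
    Arr = {w. sq_dom w \<in> Arr C \<and> sq_cod w \<in> Arr C \<and>
              sq_top w \<in> Hom C (Dom C (sq_dom w)) (Dom C (sq_cod w)) \<and>
              sq_bot w \<in> Hom C (Cod C (sq_dom w)) (Cod C (sq_cod w)) \<and>
              sq_cod w \<cdot>\<^bsub>C\<^esub> sq_top w = sq_bot w \<cdot>\<^bsub>C\<^esub> sq_dom w},
    Dom = sq_dom, Cod = sq_cod,
    Ident = (\<lambda>f. Square f (Ident C (Dom C f)) (Ident C (Cod C f)) f),
    Comp = (\<lambda>w' w. Square (sq_dom w) (sq_top w' \<cdot>\<^bsub>C\<^esub> sq_top w) (sq_bot w' \<cdot>\<^bsub>C\<^esub> sq_bot w)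
                       (sq_cod w'))\<rparr>"

section \<open>Algebraic weak factorization systems\<close>

text \<open>The factorization \<open>f = R f \<cdot> L f\<close> through \<open>E f\<close>, together with the arrows
  \<open>\<delta>\<^sub>f : E f \<rightarrow> E (L f)\<close> and \<open>\<mu>\<^sub>f : E (R f) \<rightarrow> E f\<close>.\<close>

record ('o, 'a) awfs_data =
  left :: "'a \<Rightarrow> 'a"
  right :: "'a \<Rightarrow> 'a"
  mid :: "('a, 'a square, 'o, 'a) fun_data"
  comult :: "'a \<Rightarrow> 'a"
  mult :: "'a \<Rightarrow> 'a"

definition functorial_factorization :: "('o, 'a) cat \<Rightarrow> ('o, 'a) awfs_data \<Rightarrow> bool" where
  "functorial_factorization C W \<longleftrightarrow>
    is_functor (arrow_cat C) C (mid W) \<and>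
    (\<forall>f\<in>Arr C. left W f \<in> Hom C (Dom C f) (on_obj (mid W) f) \<and>
               right W f \<in> Hom C (on_obj (mid W) f) (Cod C f) \<and>
               right W f \<cdot>\<^bsub>C\<^esub> left W f = f) \<and>
    (\<forall>w\<in>Arr (arrow_cat C).
       on_arr (mid W) w \<cdot>\<^bsub>C\<^esub> left W (sq_dom w) = left W (sq_cod w) \<cdot>\<^bsub>C\<^esub> sq_top w \<and>
       right W (sq_cod w) \<cdot>\<^bsub>C\<^esub> on_arr (mid W) w = sq_bot w \<cdot>\<^bsub>C\<^esub> right W (sq_dom w))"

definition left_fun :: "('o, 'a) awfs_data \<Rightarrow> ('a, 'a square, 'a, 'a square) fun_data" where
  "left_fun W = \<lparr>on_obj = left W,
    on_arr = (\<lambda>w. Square (left W (sq_dom w)) (sq_top w) (on_arr (mid W) w) (left W (sq_cod w)))\<rparr>"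

definition right_fun :: "('o, 'a) awfs_data \<Rightarrow> ('a, 'a square, 'a, 'a square) fun_data" where
  "right_fun W = \<lparr>on_obj = right W,
    on_arr = (\<lambda>w. Square (right W (sq_dom w)) (on_arr (mid W) w) (sq_bot w) (right W (sq_cod w)))\<rparr>"

definition counit_sq :: "('o, 'a) cat \<Rightarrow> ('o, 'a) awfs_data \<Rightarrow> 'a \<Rightarrow> 'a square" where
  "counit_sq C W f = Square (left W f) (Ident C (Dom C f)) (right W f) f"

definition unit_sq :: "('o, 'a) cat \<Rightarrow> ('o, 'a) awfs_data \<Rightarrow> 'a \<Rightarrow> 'a square" where
  "unit_sq C W f = Square f (left W f) (Ident C (Cod C f)) (right W f)"

definition comult_sq :: "('o, 'a) cat \<Rightarrow> ('o, 'a) awfs_data \<Rightarrow> 'a \<Rightarrow> 'a square" where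
  "comult_sq C W f = Square (left W f) (Ident C (Dom C f)) (comult W f) (left W (left W f))"

definition mult_sq :: "('o, 'a) cat \<Rightarrow> ('o, 'a) awfs_data \<Rightarrow> 'a \<Rightarrow> 'a square" where
  "mult_sq C W f = Square (right W (right W f)) (mult W f) (Ident C (Cod C f)) (right W f)"

definition is_awfs :: "('o, 'a) cat \<Rightarrow> ('o, 'a) awfs_data \<Rightarrow> bool" where
  "is_awfs C W \<longleftrightarrow>
    category C \<and> functorial_factorization C W \<and>
    is_comonad (arrow_cat C) (left_fun W) (counit_sq C W) (comult_sq C W) \<and>
    is_monad (arrow_cat C) (right_fun W) (unit_sq C W) (mult_sq C W) \<and>
    distributive_law (arrow_cat C)
      (left_fun W) (counit_sq C W) (comult_sq C W)
      (right_fun W) (unit_sq C W) (mult_sq C W)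
      (\<lambda>f. Square (left W (right W f)) (comult W f) (mult W f) (right W (left W f)))"

text \<open>Coalgebras and algebras are pairs of an arrow and a structure map.\<close>

definition is_coalg :: "('o, 'a) cat \<Rightarrow> ('o, 'a) awfs_data \<Rightarrow> 'a \<times> 'a \<Rightarrow> bool" where
  "is_coalg C W = (\<lambda>(j, s).
    j \<in> Arr C \<and> s \<in> Hom C (Cod C j) (on_obj (mid W) j) \<and>
    s \<cdot>\<^bsub>C\<^esub> j = left W j \<and>
    right W j \<cdot>\<^bsub>C\<^esub> s = Ident C (Cod C j) \<and>
    comult W j \<cdot>\<^bsub>C\<^esub> s = on_arr (mid W) (Square j (Ident C (Dom C j)) s (left W j)) \<cdot>\<^bsub>C\<^esub> s)"

definition is_alg :: "('o, 'a) cat \<Rightarrow> ('o, 'a) awfs_data \<Rightarrow> 'a \<times> 'a \<Rightarrow> bool" where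
  "is_alg C W = (\<lambda>(f, r).
    f \<in> Arr C \<and> r \<in> Hom C (on_obj (mid W) f) (Dom C f) \<and>
    r \<cdot>\<^bsub>C\<^esub> left W f = Ident C (Dom C f) \<and>
    f \<cdot>\<^bsub>C\<^esub> r = right W f \<and>
    r \<cdot>\<^bsub>C\<^esub> mult W f = r \<cdot>\<^bsub>C\<^esub> on_arr (mid W) (Square (right W f) r (Ident C (Cod C f)) f))"

text \<open>An arrow of the category of algebras is a triple (source, square, target).\<close>

definition alg_cat ::
  "('o, 'a) cat \<Rightarrow> ('o, 'a) awfs_data
    \<Rightarrow> ('a \<times> 'a, ('a \<times> 'a) \<times> 'a square \<times> ('a \<times> 'a)) cat" where
  "alg_cat C W = \<lparr>Obj = {x. is_alg C W x},
    Arr = {(x, w, y). is_alg C W x \<and> is_alg C W y \<and>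
                      w \<in> Hom (arrow_cat C) (fst x) (fst y) \<and>
                      snd y \<cdot>\<^bsub>C\<^esub> on_arr (mid W) w = sq_top w \<cdot>\<^bsub>C\<^esub> snd x},
    Dom = (\<lambda>(x, w, y). x), Cod = (\<lambda>(x, w, y). y),
    Ident = (\<lambda>x. (x, Ident (arrow_cat C) (fst x), x)),
    Comp = (\<lambda>(x', w', y') (x, w, y). (x, w' \<cdot>\<^bsub>arrow_cat C\<^esub> w, y'))\<rparr>"

definition forget_alg ::
  "('a \<times> 'a, ('a \<times> 'a) \<times> 'a square \<times> ('a \<times> 'a), 'a, 'a square) fun_data" where
  "forget_alg = \<lparr>on_obj = fst, on_arr = (\<lambda>(x, w, y). w)\<rparr>"

definition chosen_solution ::
  "('o, 'a) cat \<Rightarrow> ('o, 'a) awfs_data \<Rightarrow> 'a \<times> 'a \<Rightarrow> 'a \<times> 'a \<Rightarrow> 'a \<Rightarrow> 'a \<Rightarrow> 'a" where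
  "chosen_solution C W x y u v =
    snd y \<cdot>\<^bsub>C\<^esub> on_arr (mid W) (Square (fst x) u v (fst y)) \<cdot>\<^bsub>C\<^esub> snd x"

text \<open>For algebras \<open>(f, s)\<close>, \<open>(g, t)\<close> with \<open>Cod f = Dom g\<close>: the arrow \<open>g f\<close> with structure
  \<open>t \<bullet> s\<close>; note the order of the arguments.\<close>

definition comp_alg ::
  "('o, 'a) cat \<Rightarrow> ('o, 'a) awfs_data \<Rightarrow> 'a \<times> 'a \<Rightarrow> 'a \<times> 'a \<Rightarrow> 'a \<times> 'a" where
  "comp_alg C W = (\<lambda>(g, t) (f, s).
    let gf = g \<cdot>\<^bsub>C\<^esub> f;
        t' = t \<cdot>\<^bsub>C\<^esub> on_arr (mid W) (Square gf f (Ident C (Cod C g)) g)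
    in (gf, s \<cdot>\<^bsub>C\<^esub> on_arr (mid W) (Square (left W gf) (Ident C (Dom C f)) t' f) \<cdot>\<^bsub>C\<^esub> comult W gf))"

section \<open>The pullback-hom\<close>

text \<open>Throughout, \<open>Hl\<close> is the bifunctor \<open>hom\<^sub>\<ell>\<close>. The maps \<open>f\<^sup>B\<close> and \<open>X\<^sup>i\<close>:\<close>

definition exp_arr ::
  "('ok, 'ak) cat \<Rightarrow> ('ok \<times> 'on, 'ak \<times> 'an, 'om, 'am) fun_data \<Rightarrow> 'ok \<Rightarrow> 'an \<Rightarrow> 'am" where
  "exp_arr K Hl B f = on_arr Hl (Ident K B, f)"

definition exp_restr ::
  "('on, 'an) cat \<Rightarrow> ('ok \<times> 'on, 'ak \<times> 'an, 'om, 'am) fun_data \<Rightarrow> 'ak \<Rightarrow> 'on \<Rightarrow> 'am" where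
  "exp_restr N Hl i X = on_arr Hl (i, Ident N X)"

text \<open>The projections of \<open>Y\<^sup>B \<times>\<^bsub>Y\<^sup>A\<^esub> X\<^sup>A\<close> for \<open>i : A \<rightarrow> B\<close> and \<open>f : X \<rightarrow> Y\<close>.\<close>

definition hat_pb ::
  "('ok, 'ak) cat \<Rightarrow> ('on, 'an) cat \<Rightarrow> ('ok \<times> 'on, 'ak \<times> 'an, 'om, 'am) fun_data
    \<Rightarrow> ('am \<Rightarrow> 'am \<Rightarrow> 'am \<times> 'am) \<Rightarrow> 'ak \<Rightarrow> 'an \<Rightarrow> 'am \<times> 'am" where
  "hat_pb K N Hl pb i f = pb (exp_restr N Hl i (Cod N f)) (exp_arr K Hl (Dom K i) f)"

text \<open>The map \<open>b \<times> c\<close> into \<open>Y\<^sup>B \<times>\<^bsub>Y\<^sup>A\<^esub> X\<^sup>A\<close> with components \<open>b\<close> and \<open>c\<close>.\<close>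

definition hat_pair ::
  "('ok, 'ak) cat \<Rightarrow> ('om, 'am) cat \<Rightarrow> ('on, 'an) cat
    \<Rightarrow> ('ok \<times> 'on, 'ak \<times> 'an, 'om, 'am) fun_data \<Rightarrow> ('am \<Rightarrow> 'am \<Rightarrow> 'am \<times> 'am)
    \<Rightarrow> 'ak \<Rightarrow> 'an \<Rightarrow> 'am \<Rightarrow> 'am \<Rightarrow> 'am" where
  "hat_pair K M N Hl pb i f b c =
    (let p = fst (hat_pb K N Hl pb i f); q = snd (hat_pb K N Hl pb i f)
     in THE h. h \<in> Hom M (Dom M b) (Dom M p) \<and> p \<cdot>\<^bsub>M\<^esub> h = b \<and> q \<cdot>\<^bsub>M\<^esub> h = c)"

definition hat_arr ::
  "('ok, 'ak) cat \<Rightarrow> ('om, 'am) cat \<Rightarrow> ('on, 'an) cat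
    \<Rightarrow> ('ok \<times> 'on, 'ak \<times> 'an, 'om, 'am) fun_data \<Rightarrow> ('am \<Rightarrow> 'am \<Rightarrow> 'am \<times> 'am)
    \<Rightarrow> 'ak \<Rightarrow> 'an \<Rightarrow> 'am" where
  "hat_arr K M N Hl pb i f =
    hat_pair K M N Hl pb i f (exp_arr K Hl (Cod K i) f) (exp_restr N Hl i (Dom N f))"

text \<open>The map \<open>\<beta> \<times> \<gamma>\<close> from the pullback for \<open>f\<close> to the pullback for \<open>g\<close>, induced by
  \<open>\<beta>\<close> and \<open>\<gamma>\<close> on the two factors.\<close>

definition hat_prod ::
  "('ok, 'ak) cat \<Rightarrow> ('om, 'am) cat \<Rightarrow> ('on, 'an) cat
    \<Rightarrow> ('ok \<times> 'on, 'ak \<times> 'an, 'om, 'am) fun_data \<Rightarrow> ('am \<Rightarrow> 'am \<Rightarrow> 'am \<times> 'am)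
    \<Rightarrow> 'ak \<Rightarrow> 'an \<Rightarrow> 'an \<Rightarrow> 'am \<Rightarrow> 'am \<Rightarrow> 'am" where
  "hat_prod K M N Hl pb i f g \<beta> \<gamma> =
    hat_pair K M N Hl pb i g
      (\<beta> \<cdot>\<^bsub>M\<^esub> fst (hat_pb K N Hl pb i f)) (\<gamma> \<cdot>\<^bsub>M\<^esub> snd (hat_pb K N Hl pb i f))"

definition hat_hom ::
  "('ok, 'ak) cat \<Rightarrow> ('om, 'am) cat \<Rightarrow> ('on, 'an) cat
    \<Rightarrow> ('ok \<times> 'on, 'ak \<times> 'an, 'om, 'am) fun_data \<Rightarrow> ('am \<Rightarrow> 'am \<Rightarrow> 'am \<times> 'am)
    \<Rightarrow> 'ak \<Rightarrow> ('an, 'an square, 'am, 'am square) fun_data" where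
  "hat_hom K M N Hl pb i = \<lparr>on_obj = hat_arr K M N Hl pb i,
    on_arr = (\<lambda>w. Square (hat_arr K M N Hl pb i (sq_dom w))
      (exp_arr K Hl (Cod K i) (sq_top w))
      (hat_prod K M N Hl pb i (sq_dom w) (sq_cod w)
        (exp_arr K Hl (Cod K i) (sq_bot w)) (exp_arr K Hl (Dom K i) (sq_top w)))
      (hat_arr K M N Hl pb i (sq_cod w)))\<rparr>"

section \<open>Lifted functors and lax morphisms\<close>

definition lifts_to_algs ::
  "('o, 'a) cat \<Rightarrow> ('o, 'a) awfs_data \<Rightarrow> ('p, 'b) cat \<Rightarrow> ('p, 'b) awfs_data
    \<Rightarrow> ('a, 'a square, 'b, 'b square) fun_data
    \<Rightarrow> ('a \<times> 'a, ('a \<times> 'a) \<times> 'a square \<times> ('a \<times> 'a),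
        'b \<times> 'b, ('b \<times> 'b) \<times> 'b square \<times> ('b \<times> 'b)) fun_data \<Rightarrow> bool" where
  "lifts_to_algs C W D V H \<Phi> \<longleftrightarrow>
    is_functor (alg_cat C W) (alg_cat D V) \<Phi> \<and>
    (\<forall>x\<in>Obj (alg_cat C W). on_obj (forget_alg \<odot> \<Phi>) x = on_obj (H \<odot> forget_alg) x) \<and>
    (\<forall>h\<in>Arr (alg_cat C W). on_arr (forget_alg \<odot> \<Phi>) h = on_arr (H \<odot> forget_alg) h)"

text \<open>The characterizing natural transformation \<open>\<rho>\<close> of a lifting \<open>\<Phi>\<close> of \<open>H\<close>.\<close>

definition char_trans ::
  "('o, 'a) cat \<Rightarrow> ('o, 'a) awfs_data \<Rightarrow> ('p, 'b) cat \<Rightarrow> ('p, 'b) awfs_data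
    \<Rightarrow> ('a, 'a square, 'b, 'b square) fun_data
    \<Rightarrow> ('a \<times> 'a, ('a \<times> 'a) \<times> 'a square \<times> ('a \<times> 'a),
        'b \<times> 'b, ('b \<times> 'b) \<times> 'b square \<times> ('b \<times> 'b)) fun_data \<Rightarrow> 'a \<Rightarrow> 'b" where
  "char_trans C W D V H \<Phi> f =
    snd (on_obj \<Phi> (right W f, mult W f)) \<cdot>\<^bsub>D\<^esub> on_arr (mid V) (on_arr H (unit_sq C W f))"

text \<open>The three conditions on \<open>\<rho>\<close>, with \<open>V\<close> the awfs \<open>(C, F)\<close> and \<open>W\<close> the awfs \<open>(L, R)\<close>.
  The squares are \<open>rv f = (\<rho>\<^sub>f, 1 \<times> (L f)\<^sup>A)\<close> and \<open>rv' f = (1, \<rho>'\<^sub>f)\<close>. Naturality of \<open>\<rho>\<close> is not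
  repeated here: it is automatic for the transformation obtained from a lifted functor.\<close>

definition lax_conditions ::
  "('ok, 'ak) cat \<Rightarrow> ('om, 'am) cat \<Rightarrow> ('on, 'an) cat
    \<Rightarrow> ('ok \<times> 'on, 'ak \<times> 'an, 'om, 'am) fun_data \<Rightarrow> ('am \<Rightarrow> 'am \<Rightarrow> 'am \<times> 'am) \<Rightarrow> 'ak
    \<Rightarrow> ('om, 'am) awfs_data \<Rightarrow> ('on, 'an) awfs_data \<Rightarrow> ('an \<Rightarrow> 'am) \<Rightarrow> bool" where
  "lax_conditions K M N Hl pb i V W \<rho> \<longleftrightarrow>
    (let A = Dom K i; B = Cod K i;
         hat = hat_arr K M N Hl pb i;
         H = on_arr (hat_hom K M N Hl pb i);
         one_x = (\<lambda>f. hat_prod K M N Hl pb i f (right W f)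
                        (Ident M (on_obj Hl (B, Cod N f))) (exp_arr K Hl A (left W f)));
         rv = (\<lambda>f. Square (right V (hat f)) (\<rho> f) (one_x f) (hat (right W f)));
         \<rho>' = (\<lambda>f. hat_pair K M N Hl pb i (left W f)
                      (\<rho> f) (snd (hat_pb K N Hl pb i f) \<cdot>\<^bsub>M\<^esub> right V (hat f)));
         rv' = (\<lambda>f. Square (left V (hat f)) (Ident M (Dom M (hat f))) (\<rho>' f) (hat (left W f)))
     in \<forall>f\<in>Arr N.
      (\<rho> f \<cdot>\<^bsub>M\<^esub> left V (hat f) = exp_arr K Hl B (left W f) \<and>
       hat (right W f) \<cdot>\<^bsub>M\<^esub> \<rho> f = one_x f \<cdot>\<^bsub>M\<^esub> right V (hat f)) \<and>
      rv f \<cdot>\<^bsub>arrow_cat M\<^esub> mult_sq M V (hat f) =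
        H (mult_sq N W f) \<cdot>\<^bsub>arrow_cat M\<^esub> rv (right W f)
          \<cdot>\<^bsub>arrow_cat M\<^esub> on_arr (right_fun V) (rv f) \<and>
      H (comult_sq N W f) \<cdot>\<^bsub>arrow_cat M\<^esub> rv' f =
        rv' (left W f) \<cdot>\<^bsub>arrow_cat M\<^esub> on_arr (left_fun V) (rv' f)
          \<cdot>\<^bsub>arrow_cat M\<^esub> comult_sq M V (hat f))"

definition defines_lax_morphism ::
  "('ok, 'ak) cat \<Rightarrow> ('om, 'am) cat \<Rightarrow> ('on, 'an) cat
    \<Rightarrow> ('ok \<times> 'on, 'ak \<times> 'an, 'om, 'am) fun_data \<Rightarrow> ('am \<Rightarrow> 'am \<Rightarrow> 'am \<times> 'am) \<Rightarrow> 'ak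
    \<Rightarrow> ('om, 'am) awfs_data \<Rightarrow> ('on, 'an) awfs_data
    \<Rightarrow> ('an \<times> 'an, ('an \<times> 'an) \<times> 'an square \<times> ('an \<times> 'an),
        'am \<times> 'am, ('am \<times> 'am) \<times> 'am square \<times> ('am \<times> 'am)) fun_data \<Rightarrow> bool" where
  "defines_lax_morphism K M N Hl pb i V W \<Phi> \<longleftrightarrow>
    lax_conditions K M N Hl pb i V W (char_trans N W M V (hat_hom K M N Hl pb i) \<Phi>)"

end

theory Submission
  imports Defs
begin

text \<open>Write \<open>\<theta>(f, s)\<close> for the algebra structure that the lifted functor puts on the pullback-hom
  \<open>hom(i, f)\<close> of an algebra \<open>(f, s)\<close>, and \<open>\<delta>'\<close> and \<open>Q\<close> for the comultiplication and the middle functor of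
  \<open>(C, F)\<close>. Two reductions turn the theorem into a comparison of two families of equations.

  On the one side, \<open>\<theta>(f, s) = s\<^sup>B \<cdot> \<rho>\<^sub>f\<close> because \<open>(s, 1)\<close> is an algebra map from the free algebra
  \<open>(Rf, \<mu>\<^sub>f)\<close>. The unit and multiplication conditions on \<open>\<rho>\<close> hold for every lifted functor, and
  of the comultiplication condition only the component at \<open>(ELf)\<^sup>B\<close> carries information:
  \<open>\<delta>\<^sub>f\<^sup>B \<cdot> \<rho>\<^sub>f = \<rho>\<^bsub>Lf\<^esub> \<cdot> Q(1, \<rho>'\<^sub>f) \<cdot> \<delta>'\<close> (\<open>lax_iff_comult_compatible\<close>).

  On the other side, every lifting problem of a coalgebra \<open>j\<close> against \<open>hom(i, gf)\<close> factors through the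
  problem of the cofree coalgebra \<open>C(hom(i, gf))\<close> given by the counit, and both the direct and the
  two-step solution are obtained from the solution of this universal problem by precomposition. So
  the condition on lifting problems says exactly that
  \<open>\<theta>(gf, t \<bullet> s) = \<theta>(f, s) \<cdot> Q(1, d \<times> c) \<cdot> \<delta>'\<close>, where \<open>d\<close> is the intermediate solution of the universal
  problem (\<open>comp_compatible_iff_two_step\<close>).

  The first family implies the second by expanding \<open>t \<bullet> s = s \<cdot> E(1, t \<cdot> E(f, 1)) \<cdot> \<delta>\<^bsub>gf\<^esub>\<close> under
  \<open>\<theta>(gf, t \<bullet> s) = (t \<bullet> s)\<^sup>B \<cdot> \<rho>\<^bsub>gf\<^esub>\<close> and using naturality of \<open>\<rho>\<close>. For the converse, the second family is
  applied to the composable free algebras \<open>(RLf, \<mu>\<^bsub>Lf\<^esub>)\<close> and \<open>(Rf, \<mu>\<^sub>f)\<close>: the algebra map out of the free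
  algebra \<open>(Rf, \<mu>\<^sub>f)\<close> into their composite that extends \<open>LLf\<close> is \<open>\<delta>\<^sub>f\<close> itself
  (\<open>comult_eq_extension\<close>), so that the lifted functor acting on it produces \<open>\<delta>\<^sub>f\<^sup>B\<close>.

  Both directions apply the lifted functor to a composite of algebras, which is an algebra only
  thanks to the distributive law (\<open>comp_alg_is_alg\<close>).\<close>

section \<open>Calculating in a category and in its arrow category\<close>

lemma square_arr_iff:
  "Square f u v g \<in> Arr (arrow_cat C) \<longleftrightarrow>
    f \<in> Arr C \<and> g \<in> Arr C \<and>
    u \<in> Arr C \<and> Dom C u = Dom C f \<and> Cod C u = Dom C g \<and>
    v \<in> Arr C \<and> Dom C v = Cod C f \<and> Cod C v = Cod C g \<and>
    g \<cdot>\<^bsub>C\<^esub> u = v \<cdot>\<^bsub>C\<^esub> f"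
  by (auto simp: arrow_cat_def Hom_def)

lemma arrow_cat_simps:
  "Obj (arrow_cat C) = Arr C"
  "Dom (arrow_cat C) (Square f u v g) = f"
  "Cod (arrow_cat C) (Square f u v g) = g"
  "Ident (arrow_cat C) f = Square f (Ident C (Dom C f)) (Ident C (Cod C f)) f"
  "Square g' u' v' h \<cdot>\<^bsub>arrow_cat C\<^esub> Square f u v g = Square f (u' \<cdot>\<^bsub>C\<^esub> u) (v' \<cdot>\<^bsub>C\<^esub> v) h"
  by (simp_all add: arrow_cat_def)

context category
begin

lemma dom_in_obj [simp]: "f \<in> Arr C \<Longrightarrow> Dom C f \<in> Obj C"
  and cod_in_obj [simp]: "f \<in> Arr C \<Longrightarrow> Cod C f \<in> Obj C"
  using dom_obj cod_obj by auto

lemma ident_simps [simp]: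
  assumes "x \<in> Obj C"
  shows "Ident C x \<in> Arr C" "Dom C (Ident C x) = x" "Cod C (Ident C x) = x"
  using ident_hom[OF assms] by (auto simp: Hom_def)

lemma comp_simps [simp]:
  assumes "f \<in> Arr C" "g \<in> Arr C" "Dom C g = Cod C f"
  shows "g \<cdot>\<^bsub>C\<^esub> f \<in> Arr C" "Dom C (g \<cdot>\<^bsub>C\<^esub> f) = Dom C f" "Cod C (g \<cdot>\<^bsub>C\<^esub> f) = Cod C g"
  using comp_hom[of f "Dom C f" "Cod C f" g "Cod C g"] assms by (auto simp: Hom_def)

lemma ident_comp [simp]:
  "f \<in> Arr C \<Longrightarrow> Cod C f = y \<Longrightarrow> Ident C y \<cdot>\<^bsub>C\<^esub> f = f"
  "f \<in> Arr C \<Longrightarrow> Dom C f = x \<Longrightarrow> f \<cdot>\<^bsub>C\<^esub> Ident C x = f"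
  using ident_left[of f "Dom C f" "Cod C f"] ident_right[of f "Dom C f" "Cod C f"]
  by (auto simp: Hom_def)

lemma assoc [simp]:
  assumes "f \<in> Arr C" "g \<in> Arr C" "h \<in> Arr C" "Dom C g = Cod C f" "Dom C h = Cod C g"
  shows "(h \<cdot>\<^bsub>C\<^esub> g) \<cdot>\<^bsub>C\<^esub> f = h \<cdot>\<^bsub>C\<^esub> (g \<cdot>\<^bsub>C\<^esub> f)"
  using comp_assoc[of f "Dom C f" "Cod C f" g "Cod C g" h "Cod C h"] assms
  by (auto simp: Hom_def)

text \<open>Composites are normalised to the right, so an equation for \<open>g \<cdot> f\<close> does not match inside a longer
  composite; this rule makes it applicable there.\<close>

lemma extend:
  assumes "g \<cdot>\<^bsub>C\<^esub> f = h"
    and "k \<in> Arr C" "f \<in> Arr C" "g \<in> Arr C" "Dom C f = Cod C k" "Dom C g = Cod C f"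
  shows "g \<cdot>\<^bsub>C\<^esub> (f \<cdot>\<^bsub>C\<^esub> k) = h \<cdot>\<^bsub>C\<^esub> k"
  using assms assoc by metis

lemma square_comp:
  assumes "Square f u v g \<in> Arr (arrow_cat C)" "Square g u' v' h \<in> Arr (arrow_cat C)"
  shows "Square f (u' \<cdot>\<^bsub>C\<^esub> u) (v' \<cdot>\<^bsub>C\<^esub> v) h \<in> Arr (arrow_cat C)"
proof -
  have "h \<cdot>\<^bsub>C\<^esub> (u' \<cdot>\<^bsub>C\<^esub> u) = (h \<cdot>\<^bsub>C\<^esub> u') \<cdot>\<^bsub>C\<^esub> u"
    using assms by (intro assoc[symmetric]) (auto simp: square_arr_iff)
  also have "\<dots> = (v' \<cdot>\<^bsub>C\<^esub> g) \<cdot>\<^bsub>C\<^esub> u" using assms by (simp only: square_arr_iff)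
  also have "\<dots> = v' \<cdot>\<^bsub>C\<^esub> (g \<cdot>\<^bsub>C\<^esub> u)" using assms by (simp add: square_arr_iff)
  also have "\<dots> = v' \<cdot>\<^bsub>C\<^esub> (v \<cdot>\<^bsub>C\<^esub> f)" using assms by (simp only: square_arr_iff)
  finally have "h \<cdot>\<^bsub>C\<^esub> (u' \<cdot>\<^bsub>C\<^esub> u) = v' \<cdot>\<^bsub>C\<^esub> (v \<cdot>\<^bsub>C\<^esub> f)" .
  then show ?thesis using assms by (simp add: square_arr_iff)
qed

lemma square_ident [simp]:
  "f \<in> Arr C \<Longrightarrow> Square f (Ident C (Dom C f)) (Ident C (Cod C f)) f \<in> Arr (arrow_cat C)"
  by (simp add: square_arr_iff)

end

section \<open>The equations of an algebraic weak factorization system\<close>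

locale awfs =
  fixes C :: "('o, 'a) cat" and W :: "('o, 'a) awfs_data"
  assumes awfs: "is_awfs C W"

sublocale awfs \<subseteq> category C
  using awfs by (simp add: is_awfs_def)

context awfs
begin

abbreviation comp_C (infixl "\<cdot>" 70) where "g \<cdot> f \<equiv> g \<cdot>\<^bsub>C\<^esub> f"
abbreviation "L \<equiv> left W"
abbreviation "R \<equiv> right W"
abbreviation "E0 \<equiv> on_obj (mid W)"
abbreviation "E f u v g \<equiv> on_arr (mid W) (Square f u v g)"
abbreviation "\<delta> \<equiv> comult W"
abbreviation "\<mu> \<equiv> mult W"
abbreviation "id\<^sub>d f \<equiv> Ident C (Dom C f)"
abbreviation "id\<^sub>c f \<equiv> Ident C (Cod C f)"
abbreviation "sq f u v g \<equiv> Square f u v g \<in> Arr (arrow_cat C)"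

lemma factorization: "functorial_factorization C W"
  using awfs by (simp add: is_awfs_def)

lemma E_functor: "is_functor (arrow_cat C) C (mid W)"
  using factorization by (simp add: functorial_factorization_def)

lemma E_simps [simp]:
  assumes "sq f u v g"
  shows "E f u v g \<in> Arr C" "Dom C (E f u v g) = E0 f" "Cod C (E f u v g) = E0 g"
proof -
  have "E f u v g \<in> Hom C (E0 f) (E0 g)"
    using E_functor assms unfolding is_functor_def by (metis arrow_cat_simps(2,3))
  then show "E f u v g \<in> Arr C" "Dom C (E f u v g) = E0 f" "Cod C (E f u v g) = E0 g"
    by (auto simp: Hom_def)
qed

lemma E_ident [simp]: "f \<in> Arr C \<Longrightarrow> E f (id\<^sub>d f) (id\<^sub>c f) f = Ident C (E0 f)"
  using E_functor unfolding is_functor_def by (metis arrow_cat_simps(1,4))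

lemma E_comp:
  assumes "sq f u v g" "sq g u' v' h"
  shows "E g u' v' h \<cdot> E f u v g = E f (u' \<cdot> u) (v' \<cdot> v) h"
  using E_functor assms unfolding is_functor_def by (metis arrow_cat_simps(2,3,5))

lemma E0_obj [simp]: "f \<in> Arr C \<Longrightarrow> E0 f \<in> Obj C"
  using E_functor by (simp add: is_functor_def arrow_cat_simps)

lemma LR_simps [simp]:
  assumes "f \<in> Arr C"
  shows "L f \<in> Arr C" "Dom C (L f) = Dom C f" "Cod C (L f) = E0 f"
    "R f \<in> Arr C" "Dom C (R f) = E0 f" "Cod C (R f) = Cod C f" "R f \<cdot> L f = f"
  using factorization assms by (auto simp: functorial_factorization_def Hom_def)

lemma E_L: "sq f u v g \<Longrightarrow> E f u v g \<cdot> L f = L g \<cdot> u"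
  and R_E: "sq f u v g \<Longrightarrow> R g \<cdot> E f u v g = v \<cdot> R f"
  using factorization unfolding functorial_factorization_def by fastforce+

lemma sq_L: "sq f u v g \<Longrightarrow> sq (L f) u (E f u v g) (L g)"
  and sq_R: "sq f u v g \<Longrightarrow> sq (R f) (E f u v g) v (R g)"
  using E_L R_E by (auto simp: square_arr_iff[of _ _ "on_arr _ _"]
      square_arr_iff[of _ "on_arr _ _"]) (auto simp: square_arr_iff)

lemma sq_unit: "f \<in> Arr C \<Longrightarrow> sq f (L f) (id\<^sub>c f) (R f)"
  and sq_counit: "f \<in> Arr C \<Longrightarrow> sq (L f) (id\<^sub>d f) (R f) f"
  by (auto simp: square_arr_iff)

lemma comonad: "is_comonad (arrow_cat C) (left_fun W) (counit_sq C W) (comult_sq C W)"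
  and monad: "is_monad (arrow_cat C) (right_fun W) (unit_sq C W) (mult_sq C W)"
  using awfs by (simp_all add: is_awfs_def)

lemma sq_comult: "f \<in> Arr C \<Longrightarrow> sq (L f) (id\<^sub>d f) (\<delta> f) (L (L f))"
  using comonad by (simp add: is_comonad_def nat_trans_def arrow_cat_simps left_fun_def
      comp_fun_def comult_sq_def Hom_def)

lemma sq_mult: "f \<in> Arr C \<Longrightarrow> sq (R (R f)) (\<mu> f) (id\<^sub>c f) (R f)"
  using monad by (simp add: is_monad_def nat_trans_def arrow_cat_simps right_fun_def
      comp_fun_def mult_sq_def Hom_def)

lemma comult_simps [simp]:
  assumes "f \<in> Arr C"
  shows "\<delta> f \<in> Arr C" "Dom C (\<delta> f) = E0 f" "Cod C (\<delta> f) = E0 (L f)"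
  using sq_comult[OF assms] assms by (auto simp: square_arr_iff)

lemma mult_simps [simp]:
  assumes "f \<in> Arr C"
  shows "\<mu> f \<in> Arr C" "Dom C (\<mu> f) = E0 (R f)" "Cod C (\<mu> f) = E0 f"
  using sq_mult[OF assms] assms by (auto simp: square_arr_iff)

lemma comult_L: "f \<in> Arr C \<Longrightarrow> \<delta> f \<cdot> L f = L (L f)"
  using sq_comult[of f] by (simp add: square_arr_iff)

lemma R_mult: "f \<in> Arr C \<Longrightarrow> R f \<cdot> \<mu> f = R (R f)"
  using sq_mult[of f] by (simp add: square_arr_iff)

lemma comonad_laws:
  assumes "f \<in> Arr C"
  shows "R (L f) \<cdot> \<delta> f = Ident C (E0 f)"
    "E (L f) (id\<^sub>d f) (R f) f \<cdot> \<delta> f = Ident C (E0 f)"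
    "\<delta> (L f) \<cdot> \<delta> f = E (L f) (id\<^sub>d f) (\<delta> f) (L (L f)) \<cdot> \<delta> f"
  using comonad assms by (auto simp: is_comonad_def arrow_cat_simps left_fun_def
      comult_sq_def counit_sq_def)

lemma monad_laws:
  assumes "f \<in> Arr C"
  shows "\<mu> f \<cdot> L (R f) = Ident C (E0 f)"
    "\<mu> f \<cdot> E f (L f) (id\<^sub>c f) (R f) = Ident C (E0 f)"
    "\<mu> f \<cdot> \<mu> (R f) = \<mu> f \<cdot> E (R (R f)) (\<mu> f) (id\<^sub>c f) (R f)"
  using monad assms by (auto simp: is_monad_def arrow_cat_simps right_fun_def
      mult_sq_def unit_sq_def)

lemma comult_natural:
  assumes "sq f u v g"
  shows "\<delta> g \<cdot> E f u v g = E (L f) u (E f u v g) (L g) \<cdot> \<delta> f"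
  using comonad assms unfolding is_comonad_def nat_trans_def
  by (auto simp: arrow_cat_simps left_fun_def comp_fun_def comult_sq_def dest!: bspec[OF _ assms])

lemma mult_natural:
  assumes "sq f u v g"
  shows "\<mu> g \<cdot> E (R f) (E f u v g) v (R g) = E f u v g \<cdot> \<mu> f"
  using monad assms unfolding is_monad_def nat_trans_def
  by (auto simp: arrow_cat_simps right_fun_def comp_fun_def mult_sq_def dest!: bspec[OF _ assms])

text \<open>The top component of the compatibility of the distributive law with the multiplication. Its
  bottom component is the associativity of \<open>\<mu>\<close>.\<close>

lemma comult_mult:
  assumes "f \<in> Arr C"
  shows "\<delta> f \<cdot> \<mu> f = \<mu> (L f) \<cdot> E (L (R f)) (\<delta> f) (\<mu> f) (R (L f)) \<cdot> \<delta> (R f)"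
  using awfs assms by (auto simp: is_awfs_def distributive_law_def arrow_cat_simps
      left_fun_def right_fun_def mult_sq_def)

lemma sq_dist:
  assumes "f \<in> Arr C"
  shows "sq (L (R f)) (\<delta> f) (\<mu> f) (R (L f))"
  using assms by (simp add: square_arr_iff comonad_laws monad_laws)

section \<open>Algebras, coalgebras and composition of algebras\<close>

lemma alg_simps:
  assumes "is_alg C W (f, r)"
  shows "f \<in> Arr C" "r \<in> Arr C" "Dom C r = E0 f" "Cod C r = Dom C f"
    "r \<cdot> L f = id\<^sub>d f" "f \<cdot> r = R f" "r \<cdot> \<mu> f = r \<cdot> E (R f) r (id\<^sub>c f) f"
  using assms by (auto simp: is_alg_def Hom_def)

lemma sq_alg: "is_alg C W (f, r) \<Longrightarrow> sq (R f) r (id\<^sub>c f) f"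
  using alg_simps[of f r] by (simp add: square_arr_iff)

lemma free_alg: "f \<in> Arr C \<Longrightarrow> is_alg C W (R f, \<mu> f)"
  using monad_laws[of f] R_mult[of f] by (simp add: is_alg_def Hom_def)

lemma cofree_coalg: "f \<in> Arr C \<Longrightarrow> is_coalg C W (L f, \<delta> f)"
  using comonad_laws[of f] comult_L[of f] by (simp add: is_coalg_def Hom_def)

lemma coalg_simps:
  assumes "is_coalg C W (j, \<sigma>)"
  shows "j \<in> Arr C" "\<sigma> \<in> Arr C" "Dom C \<sigma> = Cod C j" "Cod C \<sigma> = E0 j"
    "\<sigma> \<cdot> j = L j" "R j \<cdot> \<sigma> = id\<^sub>c j" "\<delta> j \<cdot> \<sigma> = E j (id\<^sub>d j) \<sigma> (L j) \<cdot> \<sigma>"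
  using assms by (auto simp: is_coalg_def Hom_def)

lemma sq_coalg: "is_coalg C W (j, \<sigma>) \<Longrightarrow> sq j (id\<^sub>d j) \<sigma> (L j)"
  using coalg_simps[of j \<sigma>] by (simp add: square_arr_iff)

lemma E_comp_extend:
  assumes "sq f u v g" "sq g u' v' h" "k \<in> Arr C" "Cod C k = E0 f"
  shows "E g u' v' h \<cdot> (E f u v g \<cdot> k) = E f (u' \<cdot> u) (v' \<cdot> v) h \<cdot> k"
  using extend[OF E_comp[OF assms(1,2)]] assms by simp

text \<open>A square from a coalgebra \<open>j\<close> to \<open>h\<close> factors through the cofree coalgebra on \<open>h\<close> by the square
  \<open>(a, E(a, w) \<cdot> \<sigma>) : j \<Rightarrow> Lh\<close>; the first equation says that this square is a map of coalgebras. It is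
  what reduces arbitrary lifting problems to the universal one.\<close>

lemma coalg_map_to_cofree:
  assumes "is_coalg C W (j, \<sigma>)" "sq j a w h"
  shows "\<delta> h \<cdot> (E j a w h \<cdot> \<sigma>) = E j a (E j a w h \<cdot> \<sigma>) (L h) \<cdot> \<sigma>"
    and "sq j a (E j a w h \<cdot> \<sigma>) (L h)"
proof -
  note [simp] = coalg_simps(1-6)[OF assms(1)] sq_coalg[OF assms(1)] assms(2) sq_L[OF assms(2)]
  have h [simp]: "h \<in> Arr C" and a: "a \<cdot> id\<^sub>d j = a"
    using assms(2) by (auto simp: square_arr_iff)
  show "sq j a (E j a w h \<cdot> \<sigma>) (L h)"
    using square_comp[OF sq_coalg[OF assms(1)] sq_L[OF assms(2)]] a by simp
  have "\<delta> h \<cdot> (E j a w h \<cdot> \<sigma>) = E (L j) a (E j a w h) (L h) \<cdot> (\<delta> j \<cdot> \<sigma>)"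
    by (simp add: extend[OF comult_natural])
  also have "\<dots> = E j a (E j a w h \<cdot> \<sigma>) (L h) \<cdot> \<sigma>"
    using a by (simp add: coalg_simps(7)[OF assms(1)] E_comp_extend)
  finally show "\<delta> h \<cdot> (E j a w h \<cdot> \<sigma>) = E j a (E j a w h \<cdot> \<sigma>) (L h) \<cdot> \<sigma>" .
qed

text \<open>Dually, \<open>t \<cdot> E(u, v)\<close> is the extension of a square \<open>(u, v) : f \<Rightarrow> g\<close> to an algebra map out of
  the free algebra on \<open>f\<close>.\<close>

lemma alg_map_from_free:
  assumes "is_alg C W (g, t)" "sq f u v g"
  shows "t \<cdot> E (R f) (t \<cdot> E f u v g) v g = (t \<cdot> E f u v g) \<cdot> \<mu> f"
    and "sq (R f) (t \<cdot> E f u v g) v g"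
proof -
  note t [simp] = alg_simps[OF assms(1)]
  have f [simp]: "f \<in> Arr C" using assms(2) by (simp add: square_arr_iff)
  note [simp] = assms(2) sq_R[OF assms(2)] sq_alg[OF assms(1)]
  have v: "id\<^sub>c g \<cdot> v = v" using assms(2) by (simp add: square_arr_iff)
  show "sq (R f) (t \<cdot> E f u v g) v g"
    using square_comp[OF sq_R[OF assms(2)] sq_alg[OF assms(1)]] v by simp
  have "t \<cdot> E (R f) (t \<cdot> E f u v g) v g = t \<cdot> (E (R g) t (id\<^sub>c g) g \<cdot> E (R f) (E f u v g) v (R g))"
    using v by (simp add: E_comp)
  also have "\<dots> = (t \<cdot> \<mu> g) \<cdot> E (R f) (E f u v g) v (R g)" by simp
  also have "\<dots> = t \<cdot> (\<mu> g \<cdot> E (R f) (E f u v g) v (R g))" by (intro assoc) simp_all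
  also have "\<dots> = t \<cdot> (E f u v g \<cdot> \<mu> f)" using mult_natural[OF assms(2)] by simp
  also have "\<dots> = (t \<cdot> E f u v g) \<cdot> \<mu> f" by simp
  finally show "t \<cdot> E (R f) (t \<cdot> E f u v g) v g = (t \<cdot> E f u v g) \<cdot> \<mu> f" .
qed

text \<open>The chosen solution of \<open>(f, R(gf)) : L(gf) \<Rightarrow> g\<close>, that is, the extension of the square
  \<open>(f, 1) : gf \<Rightarrow> g\<close> to the free algebra on \<open>gf\<close>; the composite structure is then the chosen solution
  of \<open>(1, comp_lift g t f) : L(gf) \<Rightarrow> f\<close>.\<close>

definition comp_lift :: "'a \<Rightarrow> 'a \<Rightarrow> 'a \<Rightarrow> 'a" where
  "comp_lift g t f = t \<cdot> E (g \<cdot> f) f (id\<^sub>c g) g"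

definition comp_str :: "'a \<Rightarrow> 'a \<Rightarrow> 'a \<Rightarrow> 'a \<Rightarrow> 'a" where
  "comp_str g t f s = s \<cdot> E (L (g \<cdot> f)) (id\<^sub>d f) (comp_lift g t f) f \<cdot> \<delta> (g \<cdot> f)"

lemma comp_alg_eq: "comp_alg C W (g, t) (f, s) = (g \<cdot> f, comp_str g t f s)"
  by (simp add: comp_alg_def comp_str_def comp_lift_def Let_def)

context
  fixes f s g t
  assumes alg_f: "is_alg C W (f, s)" and alg_g: "is_alg C W (g, t)"
    and composable: "Dom C g = Cod C f"
begin

lemmas fg_simps = alg_simps(1-5)[OF alg_f] alg_simps(1-5)[OF alg_g] composable

lemma sq_comp_second: "sq (g \<cdot> f) f (id\<^sub>c g) g"
  using fg_simps by (simp add: square_arr_iff)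

lemma comp_lift_simps:
  shows "comp_lift g t f \<in> Arr C" "Dom C (comp_lift g t f) = E0 (g \<cdot> f)"
    "Cod C (comp_lift g t f) = Cod C f"
    "comp_lift g t f \<cdot> L (g \<cdot> f) = f" "g \<cdot> comp_lift g t f = R (g \<cdot> f)"
proof -
  let ?k = "comp_lift g t f"
  note [simp] = fg_simps sq_comp_second
  show "?k \<in> Arr C" "Dom C ?k = E0 (g \<cdot> f)" "Cod C ?k = Cod C f"
    by (simp_all add: comp_lift_def)
  have "?k \<cdot> L (g \<cdot> f) = t \<cdot> (L g \<cdot> f)"
    by (simp add: comp_lift_def E_L del: LR_simps(7))
  also have "\<dots> = (t \<cdot> L g) \<cdot> f" by (intro assoc[symmetric]) simp_all
  finally show "?k \<cdot> L (g \<cdot> f) = f" by simp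
  have "g \<cdot> ?k = (g \<cdot> t) \<cdot> E (g \<cdot> f) f (id\<^sub>c g) g"
    by (simp add: comp_lift_def)
  also have "\<dots> = R g \<cdot> E (g \<cdot> f) f (id\<^sub>c g) g" by (simp only: alg_simps(6)[OF alg_g])
  finally show "g \<cdot> ?k = R (g \<cdot> f)" by (simp add: R_E)
qed

lemma sq_comp_first: "sq (L (g \<cdot> f)) (id\<^sub>d f) (comp_lift g t f) f"
  using fg_simps comp_lift_simps by (simp add: square_arr_iff)

lemma comp_str_simps:
  shows "comp_str g t f s \<in> Arr C" "Dom C (comp_str g t f s) = E0 (g \<cdot> f)"
    "Cod C (comp_str g t f s) = Dom C f"
  using fg_simps sq_comp_first by (simp_all add: comp_str_def)

lemma comp_str_left: "f \<cdot> comp_str g t f s = comp_lift g t f"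
proof -
  let ?k = "comp_lift g t f"
  note [simp] = fg_simps sq_comp_first comp_lift_simps
  have "f \<cdot> comp_str g t f s = (f \<cdot> s) \<cdot> (E (L (g \<cdot> f)) (id\<^sub>d f) ?k f \<cdot> \<delta> (g \<cdot> f))"
    by (simp add: comp_str_def)
  also have "\<dots> = R f \<cdot> (E (L (g \<cdot> f)) (id\<^sub>d f) ?k f \<cdot> \<delta> (g \<cdot> f))"
    by (simp only: alg_simps(6)[OF alg_f])
  also have "\<dots> = ?k \<cdot> (R (L (g \<cdot> f)) \<cdot> \<delta> (g \<cdot> f))"
    by (simp add: extend[OF R_E])
  finally show ?thesis by (simp add: comonad_laws)
qed

text \<open>Associativity is the only axiom that is not immediate. Writing \<open>r = s \<cdot> E(1, k) \<cdot> \<delta>\<close> and pushing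
  \<open>\<mu>\<close> to the left through \<open>\<delta>\<close> by the distributive law, both \<open>r \<cdot> \<mu>\<close> and \<open>r \<cdot> E(r, 1)\<close> become
  \<open>s \<cdot> E(r, x) \<cdot> \<delta>\<^bsub>R(gf)\<^esub>\<close>, with \<open>x = k \<cdot> \<mu>\<close> in one case and \<open>x = k \<cdot> E(r, 1)\<close> in the other. These
  agree since \<open>k\<close> is an algebra map out of a free algebra and \<open>f \<cdot> r = k\<close>.\<close>

lemma comp_alg_is_alg: "is_alg C W (comp_alg C W (g, t) (f, s))"
proof -
  let ?h = "g \<cdot> f" and ?k = "comp_lift g t f" and ?r = "comp_str g t f s"
  let ?Ek = "E (L ?h) (id\<^sub>d f) ?k f"
  note [simp] = fg_simps sq_comp_second sq_comp_first comp_lift_simps comp_str_simps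
  have unit: "?r \<cdot> L ?h = id\<^sub>d ?h"
    by (simp add: comp_str_def comult_L E_L del: LR_simps(7))
  have over: "?h \<cdot> ?r = R ?h"
    by (simp add: comp_str_left)
  have sqr: "sq (R ?h) ?r (id\<^sub>c ?h) ?h"
    using over by (simp add: square_arr_iff)
  have sqRL: "sq (R (L ?h)) ?Ek ?k (R f)" by (rule sq_R) simp
  have sq1: "sq (L (R ?h)) (?Ek \<cdot> \<delta> ?h) (?k \<cdot> \<mu> ?h) (R f)"
    by (rule square_comp[OF sq_dist sqRL]) simp
  have "?r \<cdot> \<mu> ?h = s \<cdot> (?Ek \<cdot> (\<delta> ?h \<cdot> \<mu> ?h))"
    by (simp add: comp_str_def)
  also have "\<dots> = s \<cdot> (?Ek \<cdot> (\<mu> (L ?h) \<cdot> E (L (R ?h)) (\<delta> ?h) (\<mu> ?h) (R (L ?h)) \<cdot> \<delta> (R ?h)))"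
    by (simp only: comult_mult[of ?h] fg_simps comp_simps)
  also have "\<dots> = (s \<cdot> (?Ek \<cdot> \<mu> (L ?h))) \<cdot> (E (L (R ?h)) (\<delta> ?h) (\<mu> ?h) (R (L ?h)) \<cdot> \<delta> (R ?h))"
    by (simp add: sq_dist)
  \<comment> \<open>naturality moves \<open>\<mu>\<close> next to \<open>s\<close>, where associativity of \<open>s\<close> absorbs it\<close>
  also have "?Ek \<cdot> \<mu> (L ?h) = \<mu> f \<cdot> E (R (L ?h)) ?Ek ?k (R f)"
    by (rule mult_natural[symmetric]) simp
  also have "s \<cdot> (\<mu> f \<cdot> E (R (L ?h)) ?Ek ?k (R f)) = (s \<cdot> \<mu> f) \<cdot> E (R (L ?h)) ?Ek ?k (R f)"
    by (simp add: sqRL)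
  also have "s \<cdot> \<mu> f = s \<cdot> E (R f) s (id\<^sub>c f) f"
    by (rule alg_simps(7)[OF alg_f])
  also have "(s \<cdot> E (R f) s (id\<^sub>c f) f) \<cdot> E (R (L ?h)) ?Ek ?k (R f)
      \<cdot> (E (L (R ?h)) (\<delta> ?h) (\<mu> ?h) (R (L ?h)) \<cdot> \<delta> (R ?h))
    = s \<cdot> (E (L (R ?h)) (s \<cdot> (?Ek \<cdot> \<delta> ?h)) (?k \<cdot> \<mu> ?h) f \<cdot> \<delta> (R ?h))"
    using sq1 by (simp add: sqRL sq_dist sq_alg[OF alg_f] E_comp_extend)
  also have "s \<cdot> (?Ek \<cdot> \<delta> ?h) = ?r"
    by (simp add: comp_str_def)
  also have "?k \<cdot> \<mu> ?h = ?k \<cdot> E (R ?h) ?r (id\<^sub>c ?h) ?h"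
  proof -
    have "?k \<cdot> \<mu> ?h = t \<cdot> E (R ?h) ?k (id\<^sub>c g) g"
      using alg_map_from_free(1)[OF alg_g sq_comp_second] by (simp add: comp_lift_def)
    also have "\<dots> = t \<cdot> (E ?h f (id\<^sub>c g) g \<cdot> E (R ?h) ?r (id\<^sub>c ?h) ?h)"
      using sqr by (simp add: E_comp comp_str_left)
    finally show ?thesis using sqr by (simp add: comp_lift_def)
  qed
  also have "s \<cdot> (E (L (R ?h)) ?r (?k \<cdot> E (R ?h) ?r (id\<^sub>c ?h) ?h) f \<cdot> \<delta> (R ?h))
      = s \<cdot> ((?Ek \<cdot> E (L (R ?h)) ?r (E (R ?h) ?r (id\<^sub>c ?h) ?h) (L ?h)) \<cdot> \<delta> (R ?h))"
    using sq_L[OF sqr] by (simp add: E_comp)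
  also have "\<dots> = s \<cdot> (?Ek \<cdot> (E (L (R ?h)) ?r (E (R ?h) ?r (id\<^sub>c ?h) ?h) (L ?h) \<cdot> \<delta> (R ?h)))"
    using sq_L[OF sqr] by simp
  also have "\<dots> = s \<cdot> (?Ek \<cdot> (\<delta> ?h \<cdot> E (R ?h) ?r (id\<^sub>c ?h) ?h))"
    using comult_natural[OF sqr] by simp
  also have "\<dots> = ?r \<cdot> E (R ?h) ?r (id\<^sub>c ?h) ?h"
    using sqr by (simp add: comp_str_def)
  finally have assoc: "?r \<cdot> \<mu> ?h = ?r \<cdot> E (R ?h) ?r (id\<^sub>c ?h) ?h" .
  show ?thesis
    using unit over assoc by (simp add: comp_alg_eq is_alg_def Hom_def)
qed

end

text \<open>The comultiplication is determined by the composition of algebras: it is the extension of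
  \<open>(LLf, 1) : f \<Rightarrow> Rf \<cdot> RLf\<close> to the free algebra on \<open>f\<close>, for the composite structure on
  \<open>Rf \<cdot> RLf\<close>. In particular it is an algebra map.\<close>

lemma comult_eq_extension:
  assumes "f \<in> Arr C"
  shows "comp_str (R f) (\<mu> f) (R (L f)) (\<mu> (L f)) \<cdot> E f (L (L f)) (id\<^sub>c f) (R f \<cdot> R (L f)) = \<delta> f"
    and "sq f (L (L f)) (id\<^sub>c f) (R f \<cdot> R (L f))"
proof -
  let ?h = "R f \<cdot> R (L f)" and ?k = "comp_lift (R f) (\<mu> f) (R (L f))"
  note [simp] = assms
  have algs: "is_alg C W (R (L f), \<mu> (L f))" "is_alg C W (R f, \<mu> f)" "Dom C (R f) = Cod C (R (L f))"
    by (simp_all add: free_alg)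
  note [simp] = comp_lift_simps[OF algs]
  have [simp]: "sq (L ?h) (Ident C (E0 (L f))) ?k (R (L f))" "sq ?h (R (L f)) (id\<^sub>c f) (R f)"
    using sq_comp_first[OF algs] sq_comp_second[OF algs] by simp_all
  show sq [simp]: "sq f (L (L f)) (id\<^sub>c f) ?h" by (simp add: square_arr_iff)
  note [simp] = sq_L[OF sq]
  \<comment> \<open>the composite is \<open>\<mu>\<^sub>f \<cdot> E(RLf \<cdot> LLf, 1) = \<mu>\<^sub>f \<cdot> E(Lf, 1)\<close>\<close>
  have k: "?k \<cdot> E f (L (L f)) (id\<^sub>c f) ?h = Ident C (E0 f)"
    using sq sq_comp_second[OF algs]
    by (simp add: comp_lift_def E_comp monad_laws)
  have "comp_str (R f) (\<mu> f) (R (L f)) (\<mu> (L f)) \<cdot> E f (L (L f)) (id\<^sub>c f) ?h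
      = \<mu> (L f) \<cdot> (E (L ?h) (id\<^sub>d (R (L f))) ?k (R (L f)) \<cdot> (\<delta> ?h \<cdot> E f (L (L f)) (id\<^sub>c f) ?h))"
    by (simp add: comp_str_def)
  also have "\<delta> ?h \<cdot> E f (L (L f)) (id\<^sub>c f) ?h
      = E (L f) (L (L f)) (E f (L (L f)) (id\<^sub>c f) ?h) (L ?h) \<cdot> \<delta> f"
    by (rule comult_natural) simp
  also have "E (L ?h) (id\<^sub>d (R (L f))) ?k (R (L f)) \<cdot> \<dots>
      = E (L f) (L (L f)) (id\<^sub>c (L f)) (R (L f)) \<cdot> \<delta> f"
    using k by (simp add: E_comp_extend)
  also have "\<mu> (L f) \<cdot> \<dots> = (\<mu> (L f) \<cdot> E (L f) (L (L f)) (id\<^sub>c (L f)) (R (L f))) \<cdot> \<delta> f"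
    using sq_unit[of "L f"] by simp
  finally show "comp_str (R f) (\<mu> f) (R (L f)) (\<mu> (L f)) \<cdot> E f (L (L f)) (id\<^sub>c f) ?h = \<delta> f"
    using monad_laws(2)[of "L f"] by simp
qed

end

section \<open>The pullback-hom as a functor on arrow categories\<close>

locale pullback_hom =
  K: category K + M: category M + N: category N
  for K :: "('ok, 'ak) cat" and M :: "('om, 'am) cat" and N :: "('on, 'an) cat" +
  fixes Hl :: "('ok \<times> 'on, 'ak \<times> 'an, 'om, 'am) fun_data"
    and pb :: "'am \<Rightarrow> 'am \<Rightarrow> 'am \<times> 'am" and i :: 'ak
  assumes Hl_functor: "is_functor (prod_cat (op_cat K) N) M Hl"
    and pb: "pullback_choice M pb"
    and i [simp]: "i \<in> Arr K"
begin

abbreviation "expB \<equiv> exp_arr K Hl (Cod K i)"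
abbreviation "expA \<equiv> exp_arr K Hl (Dom K i)"
abbreviation "restr \<equiv> exp_restr N Hl i"
abbreviation "p f \<equiv> fst (hat_pb K N Hl pb i f)"
abbreviation "q f \<equiv> snd (hat_pb K N Hl pb i f)"
abbreviation "hat \<equiv> hat_arr K M N Hl pb i"
abbreviation "pair \<equiv> hat_pair K M N Hl pb i"
abbreviation "sqM f u v g \<equiv> Square f u v g \<in> Arr (arrow_cat M)"
abbreviation "sqN f u v g \<equiv> Square f u v g \<in> Arr (arrow_cat N)"
abbreviation comp_M (infixl "\<cdot>" 70) where "g \<cdot> f \<equiv> g \<cdot>\<^bsub>M\<^esub> f"

lemma Hl_arr:
  assumes "x \<in> Arr K" "f \<in> Arr N"
  shows "on_arr Hl (x, f) \<in> Arr M"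
    "Dom M (on_arr Hl (x, f)) = on_obj Hl (Cod K x, Dom N f)"
    "Cod M (on_arr Hl (x, f)) = on_obj Hl (Dom K x, Cod N f)"
proof -
  have "(x, f) \<in> Arr (prod_cat (op_cat K) N)"
    using assms by (simp add: prod_cat_def op_cat_def)
  then have "on_arr Hl (x, f) \<in> Hom M (on_obj Hl (Cod K x, Dom N f)) (on_obj Hl (Dom K x, Cod N f))"
    using Hl_functor unfolding is_functor_def by (auto simp: prod_cat_def op_cat_def)
  then show "on_arr Hl (x, f) \<in> Arr M"
    "Dom M (on_arr Hl (x, f)) = on_obj Hl (Cod K x, Dom N f)"
    "Cod M (on_arr Hl (x, f)) = on_obj Hl (Dom K x, Cod N f)"
    by (auto simp: Hom_def)
qed

lemma Hl_comp:
  assumes "x \<in> Arr K" "y \<in> Arr K" "f \<in> Arr N" "g \<in> Arr N" "Dom K x = Cod K y" "Dom N g = Cod N f"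
  shows "on_arr Hl (y, g) \<cdot> on_arr Hl (x, f) = on_arr Hl (x \<cdot>\<^bsub>K\<^esub> y, g \<cdot>\<^bsub>N\<^esub> f)"
proof -
  have "(x, f) \<in> Arr (prod_cat (op_cat K) N)" "(y, g) \<in> Arr (prod_cat (op_cat K) N)"
    "Cod (prod_cat (op_cat K) N) (x, f) = Dom (prod_cat (op_cat K) N) (y, g)"
    using assms by (simp_all add: prod_cat_def op_cat_def)
  then have "on_arr Hl ((y, g) \<cdot>\<^bsub>prod_cat (op_cat K) N\<^esub> (x, f)) = on_arr Hl (y, g) \<cdot> on_arr Hl (x, f)"
    using Hl_functor unfolding is_functor_def by blast
  then show ?thesis by (simp add: prod_cat_def op_cat_def)
qed

lemma Hl_obj [simp]: "k \<in> Obj K \<Longrightarrow> x \<in> Obj N \<Longrightarrow> on_obj Hl (k, x) \<in> Obj M"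
  using Hl_functor by (simp add: is_functor_def prod_cat_def op_cat_def)

lemma Hl_ident:
  assumes "k \<in> Obj K" "x \<in> Obj N"
  shows "on_arr Hl (Ident K k, Ident N x) = Ident M (on_obj Hl (k, x))"
proof -
  have "(k, x) \<in> Obj (prod_cat (op_cat K) N)" using assms by (simp add: prod_cat_def op_cat_def)
  then have "on_arr Hl (Ident (prod_cat (op_cat K) N) (k, x)) = Ident M (on_obj Hl (k, x))"
    using Hl_functor unfolding is_functor_def by blast
  then show ?thesis by (simp add: prod_cat_def op_cat_def)
qed

lemma exp_simps [simp]:
  assumes "k \<in> Obj K" "f \<in> Arr N"
  shows "exp_arr K Hl k f \<in> Arr M" "Dom M (exp_arr K Hl k f) = on_obj Hl (k, Dom N f)"
    "Cod M (exp_arr K Hl k f) = on_obj Hl (k, Cod N f)"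
  using assms by (simp_all add: exp_arr_def Hl_arr)

lemma exp_ident [simp]:
  "k \<in> Obj K \<Longrightarrow> x \<in> Obj N \<Longrightarrow> exp_arr K Hl k (Ident N x) = Ident M (on_obj Hl (k, x))"
  by (simp add: exp_arr_def Hl_ident)

lemma exp_comp:
  assumes "k \<in> Obj K" "f \<in> Arr N" "g \<in> Arr N" "Dom N g = Cod N f"
  shows "exp_arr K Hl k (g \<cdot>\<^bsub>N\<^esub> f) = exp_arr K Hl k g \<cdot> exp_arr K Hl k f"
  using assms by (simp add: exp_arr_def Hl_comp)

lemma restr_simps [simp]:
  assumes "x \<in> Obj N"
  shows "restr x \<in> Arr M" "Dom M (restr x) = on_obj Hl (Cod K i, x)"
    "Cod M (restr x) = on_obj Hl (Dom K i, x)"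
  using assms by (simp_all add: exp_restr_def Hl_arr)

text \<open>Both sides are \<open>hom\<^sub>\<ell>(i, f)\<close>.\<close>

lemma restr_natural: "f \<in> Arr N \<Longrightarrow> restr (Cod N f) \<cdot> expB f = expA f \<cdot> restr (Dom N f)"
  by (simp add: exp_restr_def exp_arr_def Hl_comp)

lemma hat_pullback: "f \<in> Arr N \<Longrightarrow> is_pullback M (restr (Cod N f)) (expA f) (p f) (q f)"
  using pb unfolding pullback_choice_def hat_pb_def by simp

lemma proj_simps [simp]:
  assumes "f \<in> Arr N"
  shows "p f \<in> Arr M" "q f \<in> Arr M" "Dom M (q f) = Dom M (p f)"
    "Cod M (p f) = on_obj Hl (Cod K i, Cod N f)" "Cod M (q f) = on_obj Hl (Dom K i, Dom N f)"
  using hat_pullback[OF assms] assms unfolding is_pullback_def by auto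

lemma proj_square: "f \<in> Arr N \<Longrightarrow> restr (Cod N f) \<cdot> p f = expA f \<cdot> q f"
  using hat_pullback[of f] unfolding is_pullback_def by auto

lemma proj_unique_ex:
  assumes "f \<in> Arr N" "b \<in> Arr M" "c \<in> Arr M" "Dom M c = Dom M b"
    "Cod M b = on_obj Hl (Cod K i, Cod N f)" "Cod M c = on_obj Hl (Dom K i, Dom N f)"
    "restr (Cod N f) \<cdot> b = expA f \<cdot> c"
  shows "\<exists>!h. h \<in> Hom M (Dom M b) (Dom M (p f)) \<and> p f \<cdot> h = b \<and> q f \<cdot> h = c"
proof -
  have "Dom M b \<in> Obj M" "b \<in> Hom M (Dom M b) (Dom M (restr (Cod N f)))"
    "c \<in> Hom M (Dom M b) (Dom M (expA f))"
    using assms by (simp_all add: Hom_def)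
  then show ?thesis
    using hat_pullback[OF assms(1)] assms(7) unfolding is_pullback_def by blast
qed

lemma proj_joint_mono:
  assumes "f \<in> Arr N" "h \<in> Arr M" "h' \<in> Arr M" "Dom M h' = Dom M h"
    "Cod M h = Dom M (p f)" "Cod M h' = Dom M (p f)"
    "p f \<cdot> h = p f \<cdot> h'" "q f \<cdot> h = q f \<cdot> h'"
  shows "h = h'"
proof -
  have "restr (Cod N f) \<cdot> (p f \<cdot> h) = expA f \<cdot> (q f \<cdot> h)"
    using assms(1-6) by (simp add: M.extend[OF proj_square])
  then show ?thesis
    using proj_unique_ex[of f "p f \<cdot> h" "q f \<cdot> h"] assms by (auto simp: Hom_def)
qed

lemma pair_simps:
  assumes "f \<in> Arr N" "b \<in> Arr M" "c \<in> Arr M" "Dom M c = Dom M b"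
    "Cod M b = on_obj Hl (Cod K i, Cod N f)" "Cod M c = on_obj Hl (Dom K i, Dom N f)"
    "restr (Cod N f) \<cdot> b = expA f \<cdot> c"
  shows "pair f b c \<in> Arr M" "Dom M (pair f b c) = Dom M b" "Cod M (pair f b c) = Dom M (p f)"
    "p f \<cdot> pair f b c = b" "q f \<cdot> pair f b c = c"
  using theI'[OF proj_unique_ex[OF assms]] by (auto simp: hat_pair_def Let_def Hom_def)

lemma pair_eqI:
  assumes "f \<in> Arr N" "h \<in> Arr M" "Cod M h = Dom M (p f)" "p f \<cdot> h = b" "q f \<cdot> h = c"
  shows "pair f b c = h"
proof -
  have b: "b \<in> Arr M" "Dom M b = Dom M h" "Cod M b = on_obj Hl (Cod K i, Cod N f)"
    and c: "c \<in> Arr M" "Dom M c = Dom M h" "Cod M c = on_obj Hl (Dom K i, Dom N f)"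
    using assms by auto
  have "restr (Cod N f) \<cdot> b = expA f \<cdot> c"
    using assms(1-3) unfolding assms(4,5)[symmetric] by (simp add: M.extend[OF proj_square])
  then show ?thesis
    using assms b c pair_simps[of f b c] proj_joint_mono[of f "pair f b c" h] by simp
qed

lemma hat_simps [simp]:
  assumes "f \<in> Arr N"
  shows "hat f \<in> Arr M" "Dom M (hat f) = on_obj Hl (Cod K i, Dom N f)"
    "Cod M (hat f) = Dom M (p f)" "p f \<cdot> hat f = expB f" "q f \<cdot> hat f = restr (Dom N f)"
  using pair_simps[of f "expB f" "restr (Dom N f)"] assms
  by (simp_all add: hat_arr_def restr_natural)

lemma square_NE:
  assumes "sqN f u v g"
  shows "f \<in> Arr N" "g \<in> Arr N" "u \<in> Arr N" "Dom N u = Dom N f" "Cod N u = Dom N g"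
    "v \<in> Arr N" "Dom N v = Cod N f" "Cod N v = Cod N g" "g \<cdot>\<^bsub>N\<^esub> u = v \<cdot>\<^bsub>N\<^esub> f"
  using assms by (simp_all add: square_arr_iff)

text \<open>The bottom arrow of the image of \<open>(u, v) : f \<Rightarrow> g\<close> under the pullback-hom. It is a constant of
  its own so that simplification of \<open>u\<^sup>A\<close> and \<open>v\<^sup>B\<close> does not destroy the pattern on which its rules
  match.\<close>

definition base :: "'an \<Rightarrow> 'an \<Rightarrow> 'an \<Rightarrow> 'an \<Rightarrow> 'am" where
  "base f u v g = hat_prod K M N Hl pb i f g (expB v) (expA u)"

lemma base_simps [simp]:
  assumes "sqN f u v g"
  shows "base f u v g \<in> Arr M" "Dom M (base f u v g) = Dom M (p f)"
    "Cod M (base f u v g) = Dom M (p g)"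
    "p g \<cdot> base f u v g = expB v \<cdot> p f" "q g \<cdot> base f u v g = expA u \<cdot> q f"
proof -
  note [simp] = square_NE(1-8)[OF assms]
  have "restr (Cod N g) \<cdot> (expB v \<cdot> p f) = expA v \<cdot> (restr (Cod N f) \<cdot> p f)"
    using restr_natural[of v] by (simp add: M.extend[OF restr_natural[of v, simplified]])
  also have "\<dots> = expA v \<cdot> (expA f \<cdot> q f)" by (simp only: proj_square square_NE(1)[OF assms])
  also have "\<dots> = expA (v \<cdot>\<^bsub>N\<^esub> f) \<cdot> q f" by (simp add: exp_comp)
  also have "\<dots> = expA g \<cdot> (expA u \<cdot> q f)" by (simp add: exp_comp flip: square_NE(9)[OF assms])
  finally have eq: "restr (Cod N g) \<cdot> (expB v \<cdot> p f) = expA g \<cdot> (expA u \<cdot> q f)" .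
  then show "base f u v g \<in> Arr M" "Dom M (base f u v g) = Dom M (p f)"
    "Cod M (base f u v g) = Dom M (p g)"
    "p g \<cdot> base f u v g = expB v \<cdot> p f" "q g \<cdot> base f u v g = expA u \<cdot> q f"
    using pair_simps[of g "expB v \<cdot> p f" "expA u \<cdot> q f"] by (simp_all add: base_def hat_prod_def)
qed

lemma sq_hat: "sqN f u v g \<Longrightarrow> sqM (hat f) (expB u) (base f u v g) (hat g)"
proof -
  assume sq: "sqN f u v g"
  note [simp] = square_NE(1-8)[OF sq] base_simps[OF sq]
  have "hat g \<cdot> expB u = base f u v g \<cdot> hat f"
  proof (rule proj_joint_mono[of g])
    have "expB g \<cdot> expB u = expB v \<cdot> expB f"
      using square_NE(9)[OF sq] by (simp flip: exp_comp)
    then show "p g \<cdot> (hat g \<cdot> expB u) = p g \<cdot> (base f u v g \<cdot> hat f)"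
      by (simp add: M.extend[OF hat_simps(4)] M.extend[OF base_simps(4)[OF sq]])
    show "q g \<cdot> (hat g \<cdot> expB u) = q g \<cdot> (base f u v g \<cdot> hat f)"
      using restr_natural[of u]
      by (simp add: M.extend[OF hat_simps(5)] M.extend[OF base_simps(5)[OF sq]])
  qed simp_all
  then show ?thesis by (simp add: square_arr_iff)
qed

lemma base_comp:
  assumes "sqN f u v g" "sqN g u' v' h"
  shows "base g u' v' h \<cdot> base f u v g = base f (u' \<cdot>\<^bsub>N\<^esub> u) (v' \<cdot>\<^bsub>N\<^esub> v) h"
proof -
  note [simp] = square_NE(1-8)[OF assms(1)] square_NE(1-8)[OF assms(2)]
    base_simps[OF assms(1)] base_simps[OF assms(2)] base_simps[OF N.square_comp[OF assms]]
  show ?thesis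
    by (rule proj_joint_mono[of h])
      (simp_all add: M.extend[OF base_simps(4)[OF assms(2)]] M.extend[OF base_simps(5)[OF assms(2)]]
        exp_comp)
qed

lemma base_ident: "f \<in> Arr N \<Longrightarrow> base f (Ident N (Dom N f)) (Ident N (Cod N f)) f = Ident M (Dom M (p f))"
  by (rule proj_joint_mono[of f]) simp_all

lemma hat_hom_simps [simp]:
  "on_obj (hat_hom K M N Hl pb i) f = hat f"
  "on_arr (hat_hom K M N Hl pb i) (Square f u v g) = Square (hat f) (expB u) (base f u v g) (hat g)"
  by (simp_all add: hat_hom_def base_def)

end

section \<open>The characterizing transformation of a lifted functor\<close>

locale lifted_hom =
  pullback_hom K M N Hl pb i + CF: awfs M CF + LR: awfs N LR
  for K :: "('ok, 'ak) cat" and M :: "('om, 'am) cat" and N :: "('on, 'an) cat"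
    and Hl :: "('ok \<times> 'on, 'ak \<times> 'an, 'om, 'am) fun_data"
    and pb :: "'am \<Rightarrow> 'am \<Rightarrow> 'am \<times> 'am" and i :: 'ak
    and CF :: "('om, 'am) awfs_data" and LR :: "('on, 'an) awfs_data" +
  fixes \<Phi> :: "('an \<times> 'an, ('an \<times> 'an) \<times> 'an square \<times> ('an \<times> 'an),
               'am \<times> 'am, ('am \<times> 'am) \<times> 'am square \<times> ('am \<times> 'am)) fun_data"
  assumes lifts: "lifts_to_algs N LR M CF (hat_hom K M N Hl pb i) \<Phi>"
begin

abbreviation "\<theta> f s \<equiv> snd (on_obj \<Phi> (f, s))"
abbreviation "idB f \<equiv> Ident M (on_obj Hl (Cod K i, Dom N f))"
abbreviation "hatQ f u v g \<equiv> CF.E (hat f) (expB u) (base f u v g) (hat g)"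

lemma lift_alg:
  assumes "is_alg N LR (f, s)"
  shows "on_obj \<Phi> (f, s) = (hat f, \<theta> f s)" and "is_alg M CF (hat f, \<theta> f s)"
proof -
  have x: "(f, s) \<in> Obj (alg_cat N LR)" using assms by (simp add: alg_cat_def)
  then have "fst (on_obj \<Phi> (f, s)) = hat f"
    using lifts unfolding lifts_to_algs_def by (auto simp: comp_fun_def forget_alg_def)
  then show eq: "on_obj \<Phi> (f, s) = (hat f, \<theta> f s)" by (metis prod.collapse)
  have "on_obj \<Phi> (f, s) \<in> Obj (alg_cat M CF)"
    using lifts x unfolding lifts_to_algs_def is_functor_def by blast
  then show "is_alg M CF (hat f, \<theta> f s)" using eq by (simp add: alg_cat_def)
qed

lemma lift_map:
  assumes "is_alg N LR (f, s)" "is_alg N LR (g, t)" "sqN f u v g"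
    and "t \<cdot>\<^bsub>N\<^esub> LR.E f u v g = u \<cdot>\<^bsub>N\<^esub> s"
  shows "\<theta> g t \<cdot> hatQ f u v g = expB u \<cdot> \<theta> f s"
proof -
  let ?h = "((f, s), Square f u v g, (g, t))"
  have h: "?h \<in> Arr (alg_cat N LR)"
    using assms by (simp add: alg_cat_def Hom_def arrow_cat_simps)
  have "on_arr \<Phi> ?h \<in> Hom (alg_cat M CF) (on_obj \<Phi> (Dom (alg_cat N LR) ?h))
      (on_obj \<Phi> (Cod (alg_cat N LR) ?h))"
    using lifts h unfolding lifts_to_algs_def is_functor_def by blast
  then have \<Phi>h: "on_arr \<Phi> ?h \<in> Hom (alg_cat M CF) (on_obj \<Phi> (f, s)) (on_obj \<Phi> (g, t))"
    by (simp add: alg_cat_def)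
  have "on_arr (forget_alg \<odot> \<Phi>) ?h = on_arr (hat_hom K M N Hl pb i \<odot> forget_alg) ?h"
    using lifts h unfolding lifts_to_algs_def by blast
  then have w: "fst (snd (on_arr \<Phi> ?h)) = Square (hat f) (expB u) (base f u v g) (hat g)"
    by (simp add: comp_fun_def forget_alg_def split: prod.splits)
  obtain x w y where xwy: "on_arr \<Phi> ?h = (x, w, y)" by (metis prod.exhaust)
  then show ?thesis using \<Phi>h w by (auto simp: Hom_def alg_cat_def)
qed

lemma \<theta>_simps [simp]:
  assumes "is_alg N LR (f, s)"
  shows "\<theta> f s \<in> Arr M" "Dom M (\<theta> f s) = CF.E0 (hat f)" "Cod M (\<theta> f s) = on_obj Hl (Cod K i, Dom N f)"
    "hat f \<cdot> \<theta> f s = CF.R (hat f)" "\<theta> f s \<cdot> CF.L (hat f) = idB f"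
  using CF.alg_simps[OF lift_alg(2)[OF assms]] LR.alg_simps(1)[OF assms] by simp_all

definition \<rho> :: "'an \<Rightarrow> 'am" where
  "\<rho> f = \<theta> (LR.R f) (LR.\<mu> f) \<cdot> hatQ f (LR.L f) (LR.id\<^sub>c f) (LR.R f)"

lemma \<rho>_eq_char_trans: "\<rho> = char_trans N LR M CF (hat_hom K M N Hl pb i) \<Phi>"
  by (rule ext) (simp add: \<rho>_def char_trans_def unit_sq_def)

lemma hatQ_simps [simp]:
  assumes "sqN f u v g"
  shows "hatQ f u v g \<in> Arr M" "Dom M (hatQ f u v g) = CF.E0 (hat f)"
    "Cod M (hatQ f u v g) = CF.E0 (hat g)"
  using sq_hat[OF assms] by simp_all

lemma hatQ_comp:
  assumes "sqN f u v g" "sqN g u' v' h"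
  shows "hatQ g u' v' h \<cdot> hatQ f u v g = hatQ f (u' \<cdot>\<^bsub>N\<^esub> u) (v' \<cdot>\<^bsub>N\<^esub> v) h"
  using CF.E_comp[OF sq_hat[OF assms(1)] sq_hat[OF assms(2)]] square_NE[OF assms(1)] square_NE[OF assms(2)]
  by (simp add: base_comp[OF assms] exp_comp)

lemma \<rho>_simps [simp]:
  assumes "f \<in> Arr N"
  shows "\<rho> f \<in> Arr M" "Dom M (\<rho> f) = CF.E0 (hat f)" "Cod M (\<rho> f) = on_obj Hl (Cod K i, LR.E0 f)"
  using assms LR.free_alg[OF assms] LR.sq_unit[OF assms] by (simp_all add: \<rho>_def)

text \<open>The square \<open>(s, 1) : Rf \<Rightarrow> f\<close> is an algebra map from the free algebra to \<open>(f, s)\<close>, and it is a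
  retraction of the unit square from which \<open>\<rho>\<close> is built.\<close>

lemma \<theta>_eq_\<rho>:
  assumes "is_alg N LR (f, s)"
  shows "\<theta> f s = expB s \<cdot> \<rho> f"
proof -
  note [simp] = LR.alg_simps[OF assms] LR.free_alg LR.sq_unit LR.sq_alg[OF assms] assms
  have "expB s \<cdot> \<rho> f
      = (expB s \<cdot> \<theta> (LR.R f) (LR.\<mu> f)) \<cdot> hatQ f (LR.L f) (LR.id\<^sub>c f) (LR.R f)"
    by (simp add: \<rho>_def)
  also have "expB s \<cdot> \<theta> (LR.R f) (LR.\<mu> f) = \<theta> f s \<cdot> hatQ (LR.R f) s (LR.id\<^sub>c f) f"
    by (rule lift_map[symmetric]) simp_all
  also have "\<dots> \<cdot> hatQ f (LR.L f) (LR.id\<^sub>c f) (LR.R f)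
      = \<theta> f s \<cdot> hatQ f (LR.id\<^sub>d f) (LR.id\<^sub>c f) f"
    by (simp add: hatQ_comp)
  also have "hatQ f (LR.id\<^sub>d f) (LR.id\<^sub>c f) f = Ident M (CF.E0 (hat f))"
    using CF.E_ident[of "hat f"] by (simp add: base_ident)
  finally show ?thesis by simp
qed

text \<open>\<open>\<rho>\<close> inherits naturality from the lifted functor, because \<open>(E(u, v), v)\<close> is a map of free
  algebras.\<close>

lemma \<rho>_natural:
  assumes "sqN f u v g"
  shows "\<rho> g \<cdot> hatQ f u v g = expB (LR.E f u v g) \<cdot> \<rho> f"
proof -
  note [simp] = square_NE(1-8)[OF assms] assms LR.free_alg LR.sq_unit LR.sq_R[OF assms]
  have "\<rho> g \<cdot> hatQ f u v g = \<theta> (LR.R g) (LR.\<mu> g) \<cdot> hatQ f (LR.L g \<cdot>\<^bsub>N\<^esub> u) v (LR.R g)"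
    by (simp add: \<rho>_def hatQ_comp)
  also have "\<dots> = (\<theta> (LR.R g) (LR.\<mu> g) \<cdot> hatQ (LR.R f) (LR.E f u v g) v (LR.R g))
      \<cdot> hatQ f (LR.L f) (LR.id\<^sub>c f) (LR.R f)"
    by (simp add: hatQ_comp LR.E_L)
  also have "\<theta> (LR.R g) (LR.\<mu> g) \<cdot> hatQ (LR.R f) (LR.E f u v g) v (LR.R g)
      = expB (LR.E f u v g) \<cdot> \<theta> (LR.R f) (LR.\<mu> f)"
    by (rule lift_map) (simp_all add: LR.mult_natural)
  finally show ?thesis by (simp add: \<rho>_def)
qed

lemma \<rho>_unit:
  assumes [simp]: "f \<in> Arr N"
  shows "\<rho> f \<cdot> CF.L (hat f) = expB (LR.L f)"
  using sq_hat[OF LR.sq_unit[OF assms]]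
  by (simp add: \<rho>_def LR.free_alg LR.sq_unit CF.E_L M.extend[OF \<theta>_simps(5)])

lemma hat_\<rho>:
  assumes [simp]: "f \<in> Arr N"
  shows "hat (LR.R f) \<cdot> \<rho> f = base f (LR.L f) (LR.id\<^sub>c f) (LR.R f) \<cdot> CF.R (hat f)"
  using sq_hat[OF LR.sq_unit[OF assms]]
  by (simp add: \<rho>_def LR.free_alg LR.sq_unit CF.R_E M.extend[OF \<theta>_simps(4)])

lemma sq_\<rho>:
  "f \<in> Arr N \<Longrightarrow> sqM (CF.R (hat f)) (\<rho> f) (base f (LR.L f) (LR.id\<^sub>c f) (LR.R f)) (hat (LR.R f))"
  by (simp add: square_arr_iff hat_\<rho> LR.sq_unit)

text \<open>The top component of the multiplication condition. With \<open>\<theta>\<close> the structure assigned to the free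
  algebra, \<open>\<rho>\<^sub>f\<close> is the extension of the image of the unit square along \<open>\<theta>\<close>, hence an algebra map, and
  \<open>\<theta> = \<mu>\<^sub>f\<^sup>B \<cdot> \<rho>\<^bsub>Rf\<^esub>\<close>.\<close>

lemma \<rho>_mult:
  assumes [simp]: "f \<in> Arr N"
  shows "\<rho> f \<cdot> CF.\<mu> (hat f) = expB (LR.\<mu> f) \<cdot> \<rho> (LR.R f)
      \<cdot> CF.E (CF.R (hat f)) (\<rho> f) (base f (LR.L f) (LR.id\<^sub>c f) (LR.R f)) (hat (LR.R f))"
proof -
  let ?\<theta> = "\<theta> (LR.R f) (LR.\<mu> f)" and ?b = "base f (LR.L f) (LR.id\<^sub>c f) (LR.R f)"
    and ?u = "hatQ f (LR.L f) (LR.id\<^sub>c f) (LR.R f)"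
  have alg: "is_alg N LR (LR.R f, LR.\<mu> f)" by (simp add: LR.free_alg)
  note [simp] = alg LR.sq_unit sq_hat[OF LR.sq_unit[OF assms]] CF.sq_R[OF sq_hat[OF LR.sq_unit[OF assms]]]
    CF.sq_alg[OF lift_alg(2)[OF alg]] CF.alg_map_from_free(2)[OF lift_alg(2)[OF alg] sq_hat[OF LR.sq_unit[OF assms]]]
  have "\<rho> f \<cdot> CF.\<mu> (hat f) = (?\<theta> \<cdot> ?u) \<cdot> CF.\<mu> (hat f)"
    by (simp add: \<rho>_def)
  also have "\<dots> = ?\<theta> \<cdot> CF.E (CF.R (hat f)) (?\<theta> \<cdot> ?u) ?b (hat (LR.R f))"
    by (rule CF.alg_map_from_free(1)[OF lift_alg(2), symmetric]) simp_all
  finally show ?thesis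
    using \<theta>_eq_\<rho>[OF alg] sq_\<rho>[OF assms] by (simp add: \<rho>_def)
qed

definition \<rho>' :: "'an \<Rightarrow> 'am" where
  "\<rho>' f = pair (LR.L f) (\<rho> f) (q f \<cdot> CF.R (hat f))"

lemma \<rho>'_simps [simp]:
  assumes [simp]: "f \<in> Arr N"
  shows "\<rho>' f \<in> Arr M" "Dom M (\<rho>' f) = CF.E0 (hat f)" "Cod M (\<rho>' f) = Dom M (p (LR.L f))"
    "p (LR.L f) \<cdot> \<rho>' f = \<rho> f" "q (LR.L f) \<cdot> \<rho>' f = q f \<cdot> CF.R (hat f)"
proof -
  have "restr (LR.E0 f) \<cdot> \<rho> f = q (LR.R f) \<cdot> (hat (LR.R f) \<cdot> \<rho> f)"
    by (simp add: M.extend[OF hat_simps(5)])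
  also have "\<dots> = expA (LR.L f) \<cdot> (q f \<cdot> CF.R (hat f))"
    by (simp add: hat_\<rho> LR.sq_unit M.extend[OF base_simps(5)])
  finally show "\<rho>' f \<in> Arr M" "Dom M (\<rho>' f) = CF.E0 (hat f)" "Cod M (\<rho>' f) = Dom M (p (LR.L f))"
    "p (LR.L f) \<cdot> \<rho>' f = \<rho> f" "q (LR.L f) \<cdot> \<rho>' f = q f \<cdot> CF.R (hat f)"
    using pair_simps[of "LR.L f" "\<rho> f" "q f \<cdot> CF.R (hat f)"] by (simp_all add: \<rho>'_def)
qed

lemma sq_\<rho>':
  assumes [simp]: "f \<in> Arr N"
  shows "sqM (CF.L (hat f)) (idB f) (\<rho>' f) (hat (LR.L f))"
proof -
  have "\<rho>' f \<cdot> CF.L (hat f) = hat (LR.L f)"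
    by (rule proj_joint_mono[of "LR.L f"])
      (simp_all add: M.extend[OF \<rho>'_simps(4)] M.extend[OF \<rho>'_simps(5)] \<rho>_unit)
  then show ?thesis by (simp add: square_arr_iff)
qed

section \<open>Lax morphisms as compatibility with comultiplication\<close>

text \<open>The component at \<open>(ELf)\<^sup>B\<close> of the comultiplication condition on \<open>\<rho>\<close>.\<close>

definition comult_compatible :: "'an \<Rightarrow> bool" where
  "comult_compatible f \<longleftrightarrow>
    expB (LR.\<delta> f) \<cdot> \<rho> f =
    \<rho> (LR.L f) \<cdot> CF.E (CF.L (hat f)) (idB f) (\<rho>' f) (hat (LR.L f)) \<cdot> CF.\<delta> (hat f)"

text \<open>Recognises \<open>1 \<times> (Lf)\<^sup>A\<close>, written with an identity of \<open>M\<close>, as the bottom of the image of the unit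
  square. The codomain is a free variable because \<open>Cod N (R f)\<close> is
  simplified to \<open>Cod N f\<close>.\<close>

lemma base_unit_eq:
  "f \<in> Arr N \<Longrightarrow> Cod N f = y \<Longrightarrow> hat_prod K M N Hl pb i f (LR.R f)
     (Ident M (on_obj Hl (Cod K i, y))) (expA (LR.L f)) = base f (LR.L f) (Ident N y) (LR.R f)"
  by (auto simp: base_def)

text \<open>The bottom arrows of the two sides of the comultiplication condition always agree in the component
  at \<open>X\<^sup>A\<close>: by the counit law both are the \<open>X\<^sup>A\<close>-component of the right factor of \<open>hom(i, f)\<close>.\<close>

lemma comult_compatible_iff_base:
  assumes [simp]: "f \<in> Arr N"
  shows "comult_compatible f \<longleftrightarrow>
    base (LR.L f) (LR.id\<^sub>d f) (LR.\<delta> f) (LR.L (LR.L f)) \<cdot> \<rho>' f =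
    \<rho>' (LR.L f) \<cdot> CF.E (CF.L (hat f)) (idB f) (\<rho>' f) (hat (LR.L f)) \<cdot> CF.\<delta> (hat f)"
    (is "_ \<longleftrightarrow> ?l = ?r")
proof -
  have sq\<delta>: "sqN (LR.L f) (LR.id\<^sub>d f) (LR.\<delta> f) (LR.L (LR.L f))" by (rule LR.sq_comult) simp
  note [simp] = base_simps[OF sq\<delta>] sq_\<rho>'
  have pl: "p (LR.L (LR.L f)) \<cdot> ?l = expB (LR.\<delta> f) \<cdot> \<rho> f"
    by (simp add: M.extend[OF base_simps(4)[OF sq\<delta>]])
  have pr: "p (LR.L (LR.L f)) \<cdot> ?r =
      \<rho> (LR.L f) \<cdot> CF.E (CF.L (hat f)) (idB f) (\<rho>' f) (hat (LR.L f)) \<cdot> CF.\<delta> (hat f)"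
    by (simp add: M.extend[OF \<rho>'_simps(4)])
  have "q (LR.L (LR.L f)) \<cdot> ?r = q (LR.L f) \<cdot> (\<rho>' f \<cdot> (CF.R (CF.L (hat f)) \<cdot> CF.\<delta> (hat f)))"
    by (simp add: M.extend[OF \<rho>'_simps(5)] M.extend[OF CF.R_E])
  also have "\<dots> = q f \<cdot> CF.R (hat f)" by (simp add: CF.comonad_laws)
  also have "\<dots> = q (LR.L (LR.L f)) \<cdot> ?l"
    by (simp add: M.extend[OF base_simps(5)[OF sq\<delta>]])
  finally have "?l = ?r \<longleftrightarrow> p (LR.L (LR.L f)) \<cdot> ?l = p (LR.L (LR.L f)) \<cdot> ?r"
    using proj_joint_mono[of "LR.L (LR.L f)" ?l ?r] by auto
  then show ?thesis unfolding pl pr comult_compatible_def by simp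
qed

lemma base_\<rho>_mult:
  assumes [simp]: "f \<in> Arr N"
  shows "base (LR.R (LR.R f)) (LR.\<mu> f) (LR.id\<^sub>c f) (LR.R f)
      \<cdot> base (LR.R f) (LR.L (LR.R f)) (LR.id\<^sub>c f) (LR.R (LR.R f))
      \<cdot> base f (LR.L f) (LR.id\<^sub>c f) (LR.R f)
    = base f (LR.L f) (LR.id\<^sub>c f) (LR.R f)"
  using LR.sq_mult[of f] LR.sq_unit[of "LR.R f"] LR.sq_unit[of f] base_ident[of "LR.R f"]
  by (simp add: base_comp LR.monad_laws)

text \<open>Only the bottom of the comultiplication square is not automatic.\<close>

lemma lax_iff_comult_compatible:
  "defines_lax_morphism K M N Hl pb i CF LR \<Phi> \<longleftrightarrow> (\<forall>f\<in>Arr N. comult_compatible f)"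
proof -
  have "comult_compatible f \<longleftrightarrow>
      base (LR.L f) (LR.id\<^sub>d f) (LR.\<delta> f) (LR.L (LR.L f)) \<cdot>
        pair (LR.L f) (\<rho> f) (q f \<cdot> CF.R (hat f)) =
      pair (LR.L (LR.L f)) (\<rho> (LR.L f)) (q (LR.L f) \<cdot> CF.R (hat (LR.L f))) \<cdot>
        CF.E (CF.L (hat f)) (idB f) (pair (LR.L f) (\<rho> f) (q f \<cdot> CF.R (hat f))) (hat (LR.L f)) \<cdot>
        CF.\<delta> (hat f)" if "f \<in> Arr N" for f
    using comult_compatible_iff_base[OF that] unfolding \<rho>'_def .
  note this [simp]
  have [simp]: "base (LR.R (LR.R f)) (LR.\<mu> f) (LR.id\<^sub>c f) (LR.R f)
      \<cdot> (base (LR.R f) (LR.L (LR.R f)) (LR.id\<^sub>c f) (LR.R (LR.R f))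
      \<cdot> base f (LR.L f) (LR.id\<^sub>c f) (LR.R f))
    = base f (LR.L f) (LR.id\<^sub>c f) (LR.R f)" if "f \<in> Arr N" for f
    using base_\<rho>_mult[OF that] that LR.sq_mult[of f] LR.sq_unit[of "LR.R f"] LR.sq_unit[of f]
    by simp
  have [simp]: "expB (LR.\<mu> f) \<cdot> (\<rho> (LR.R f)
      \<cdot> CF.E (CF.R (hat f)) (\<rho> f) (base f (LR.L f) (LR.id\<^sub>c f) (LR.R f)) (hat (LR.R f)))
      = \<rho> f \<cdot> CF.\<mu> (hat f)" if "f \<in> Arr N" for f
    using \<rho>_mult[OF that] that sq_\<rho>[OF that] by simp
  have [simp]: "sqN (LR.R f) (LR.L (LR.R f)) (LR.id\<^sub>c f) (LR.R (LR.R f))" if "f \<in> Arr N" for f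
    using LR.sq_unit[of "LR.R f"] that by simp
  note sqs = sq_\<rho> sq_\<rho>' LR.sq_unit LR.sq_mult LR.sq_comult
  show ?thesis
    unfolding defines_lax_morphism_def lax_conditions_def Let_def \<rho>_eq_char_trans[symmetric]
    by (rule ball_cong[OF refl])
      (simp add: base_unit_eq arrow_cat_simps mult_sq_def comult_sq_def
        left_fun_def right_fun_def sqs \<rho>_unit hat_\<rho>)
qed

section \<open>Solving a lifting problem against a composite in two steps\<close>

lemma chosen_solution_lift:
  assumes "is_alg N LR (f, s)"
  shows "chosen_solution M CF (j, \<sigma>) (on_obj \<Phi> (f, s)) u v = \<theta> f s \<cdot> CF.E j u v (hat f) \<cdot> \<sigma>"
  by (subst lift_alg(1)[OF assms]) (simp add: chosen_solution_def)

text \<open>The intermediate solution \<open>d\<close> of the universal lifting problem \<open>C hom(i, gf) \<Rightarrow> hom(i, gf)\<close> given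
  by the counit of \<open>(C, F)\<close>.\<close>

definition upper_lift :: "'an \<Rightarrow> 'an \<Rightarrow> 'an \<Rightarrow> 'am" where
  "upper_lift g t f = \<theta> g t \<cdot> hatQ (g \<cdot>\<^bsub>N\<^esub> f) f (LR.id\<^sub>c g) g"

text \<open>The map \<open>d \<times> c\<close> of the second step for the same universal problem.\<close>

definition upper_pair :: "'an \<Rightarrow> 'an \<Rightarrow> 'an \<Rightarrow> 'am" where
  "upper_pair g t f = pair f (upper_lift g t f) (q (g \<cdot>\<^bsub>N\<^esub> f) \<cdot> CF.R (hat (g \<cdot>\<^bsub>N\<^esub> f)))"

text \<open>The direct and the two-step solution of the universal problem agree. The cofree coalgebra structure
  \<open>\<delta>'\<close> cancels against the counit on the direct side.\<close>

definition comp_compatible :: "'an \<Rightarrow> 'an \<Rightarrow> 'an \<Rightarrow> 'an \<Rightarrow> bool" where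
  "comp_compatible g t f s \<longleftrightarrow>
    \<theta> (g \<cdot>\<^bsub>N\<^esub> f) (LR.comp_str g t f s) =
    \<theta> f s \<cdot> CF.E (CF.L (hat (g \<cdot>\<^bsub>N\<^esub> f))) (idB f) (upper_pair g t f) (hat f) \<cdot> CF.\<delta> (hat (g \<cdot>\<^bsub>N\<^esub> f))"

context
  fixes f s g t
  assumes alg_f: "is_alg N LR (f, s)" and alg_g: "is_alg N LR (g, t)"
    and composable: "Dom N g = Cod N f"
begin

lemmas fg_simps = LR.alg_simps(1-4)[OF alg_f] LR.alg_simps(1-4)[OF alg_g] composable alg_f alg_g
  LR.sq_comp_second[OF alg_f alg_g composable]
  sq_hat[OF LR.sq_comp_second[OF alg_f alg_g composable]]

lemma upper_lift_simps:
  shows "upper_lift g t f \<in> Arr M" "Dom M (upper_lift g t f) = CF.E0 (hat (g \<cdot>\<^bsub>N\<^esub> f))"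
    "Cod M (upper_lift g t f) = on_obj Hl (Cod K i, Cod N f)"
  using fg_simps by (simp_all add: upper_lift_def)

lemma upper_pair_simps:
  shows "upper_pair g t f \<in> Arr M" "Dom M (upper_pair g t f) = CF.E0 (hat (g \<cdot>\<^bsub>N\<^esub> f))"
    "Cod M (upper_pair g t f) = Dom M (p f)"
    "p f \<cdot> upper_pair g t f = upper_lift g t f"
    "q f \<cdot> upper_pair g t f = q (g \<cdot>\<^bsub>N\<^esub> f) \<cdot> CF.R (hat (g \<cdot>\<^bsub>N\<^esub> f))"
proof -
  let ?h = "g \<cdot>\<^bsub>N\<^esub> f"
  note [simp] = fg_simps upper_lift_simps
  have "restr (Cod N f) \<cdot> upper_lift g t f = q g \<cdot> (hat g \<cdot> upper_lift g t f)"
    by (simp add: M.extend[OF hat_simps(5)])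
  also have "\<dots> = expA f \<cdot> (q ?h \<cdot> CF.R (hat ?h))"
  proof -
    have "hat g \<cdot> upper_lift g t f = CF.R (hat g) \<cdot> hatQ ?h f (LR.id\<^sub>c g) g"
      by (simp add: upper_lift_def M.extend[OF \<theta>_simps(4)])
    also have "\<dots> = base ?h f (LR.id\<^sub>c g) g \<cdot> CF.R (hat ?h)"
      by (simp add: CF.R_E)
    finally show ?thesis by (simp add: M.extend[OF base_simps(5)])
  qed
  finally show "upper_pair g t f \<in> Arr M" "Dom M (upper_pair g t f) = CF.E0 (hat ?h)"
    "Cod M (upper_pair g t f) = Dom M (p f)"
    "p f \<cdot> upper_pair g t f = upper_lift g t f"
    "q f \<cdot> upper_pair g t f = q ?h \<cdot> CF.R (hat ?h)"
    using pair_simps[of f "upper_lift g t f" "q ?h \<cdot> CF.R (hat ?h)"] by (simp_all add: upper_pair_def)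
qed

lemma sq_upper_pair: "sqM (CF.L (hat (g \<cdot>\<^bsub>N\<^esub> f))) (idB f) (upper_pair g t f) (hat f)"
proof -
  note [simp] = fg_simps upper_lift_simps upper_pair_simps
  have "upper_lift g t f \<cdot> CF.L (hat (g \<cdot>\<^bsub>N\<^esub> f)) = expB f"
    by (simp add: upper_lift_def CF.E_L M.extend[OF \<theta>_simps(5)])
  note [simp] = this
  have "upper_pair g t f \<cdot> CF.L (hat (g \<cdot>\<^bsub>N\<^esub> f)) = hat f"
    by (rule proj_joint_mono[of f])
      (simp_all add: M.extend[OF upper_pair_simps(4)] M.extend[OF upper_pair_simps(5)])
  then show ?thesis by (simp add: square_arr_iff)
qed

text \<open>With \<open>z = Q(a, w) \<cdot> \<sigma>\<close>, every ingredient of the two-step solution is the corresponding ingredient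
  of the universal one precomposed with \<open>z\<close>: this holds for \<open>d\<close> by functoriality, for \<open>c\<close> because
  \<open>\<sigma>\<close> is a section of the right factor of \<open>j\<close>, and for the last step because \<open>z\<close> underlies a map into
  the cofree coalgebra.\<close>

lemma two_step_solution:
  assumes coalg: "is_coalg M CF (j, \<sigma>)" and sq: "sqM j a w (hat (g \<cdot>\<^bsub>N\<^esub> f))"
    and b: "p (g \<cdot>\<^bsub>N\<^esub> f) \<cdot> w = b" and c: "q (g \<cdot>\<^bsub>N\<^esub> f) \<cdot> w = c"
    and d: "d = chosen_solution M CF (j, \<sigma>) (on_obj \<Phi> (g, t)) (expB f \<cdot> a) (pair g b (expA f \<cdot> c))"
  shows "chosen_solution M CF (j, \<sigma>) (on_obj \<Phi> (f, s)) a (pair f d c) =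
    (\<theta> f s \<cdot> CF.E (CF.L (hat (g \<cdot>\<^bsub>N\<^esub> f))) (idB f) (upper_pair g t f) (hat f) \<cdot> CF.\<delta> (hat (g \<cdot>\<^bsub>N\<^esub> f)))
    \<cdot> (CF.E j a w (hat (g \<cdot>\<^bsub>N\<^esub> f)) \<cdot> \<sigma>)"
proof -
  let ?h = "g \<cdot>\<^bsub>N\<^esub> f"
  let ?base = "base ?h f (LR.id\<^sub>c g) g"
  let ?z = "CF.E j a w (hat ?h) \<cdot> \<sigma>"
  note [simp] = fg_simps upper_lift_simps upper_pair_simps sq_upper_pair
  have w [simp]: "w \<in> Arr M" "Dom M w = Cod M j" "Cod M w = Dom M (p ?h)"
    and a [simp]: "a \<in> Arr M" "Dom M a = Dom M j" "Cod M a = on_obj Hl (Cod K i, Dom N f)"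
    using sq by (simp_all add: square_arr_iff)
  note [simp] = CF.coalg_simps(1-6)[OF coalg] sq CF.coalg_map_to_cofree(2)[OF coalg sq]
  have "pair g b (expA f \<cdot> c) = ?base \<cdot> w"
    by (rule pair_eqI)
      (simp_all add: M.extend[OF base_simps(4)] M.extend[OF base_simps(5)] flip: b c)
  then have "d = \<theta> g t \<cdot> (CF.E j (expB f \<cdot> a) (?base \<cdot> w) (hat g) \<cdot> \<sigma>)"
    using M.square_comp[OF sq sq_hat[of ?h f "LR.id\<^sub>c g" g]]
    by (simp add: d chosen_solution_lift[OF alg_g])
  also have "\<dots> = upper_lift g t f \<cdot> ?z"
    by (simp add: upper_lift_def CF.E_comp_extend)
  finally have d: "d = upper_lift g t f \<cdot> ?z" .
  have c: "c = q ?h \<cdot> (CF.R (hat ?h) \<cdot> ?z)"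
    by (simp add: M.extend[OF CF.R_E] flip: c)
  have pair: "pair f d c = upper_pair g t f \<cdot> ?z"
    by (rule pair_eqI)
      (simp_all add: M.extend[OF upper_pair_simps(4)] M.extend[OF upper_pair_simps(5)] d c)
  have "sqM j a (upper_pair g t f \<cdot> ?z) (hat f)"
    using M.square_comp[OF CF.coalg_map_to_cofree(2)[OF coalg sq] sq_upper_pair] by simp
  then have "chosen_solution M CF (j, \<sigma>) (on_obj \<Phi> (f, s)) a (pair f d c)
      = \<theta> f s \<cdot> (CF.E j a (upper_pair g t f \<cdot> ?z) (hat f) \<cdot> \<sigma>)"
    by (simp add: chosen_solution_lift[OF alg_f] pair)
  also have "CF.E j a (upper_pair g t f \<cdot> ?z) (hat f) \<cdot> \<sigma>
      = CF.E (CF.L (hat ?h)) (idB f) (upper_pair g t f) (hat f) \<cdot> (CF.\<delta> (hat ?h) \<cdot> ?z)"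
    by (simp add: CF.coalg_map_to_cofree(1)[OF coalg sq] CF.E_comp_extend)
  finally show ?thesis by simp
qed

lemma comp_compatible_iff_two_step:
  "comp_compatible g t f s \<longleftrightarrow>
    (\<forall>j \<sigma> a b c.
      is_coalg M CF (j, \<sigma>) \<and> b \<in> Hom M (Cod M j) (on_obj Hl (Cod K i, Cod N g)) \<and>
      c \<in> Hom M (Cod M j) (on_obj Hl (Dom K i, Dom N f)) \<and>
      restr (Cod N g) \<cdot> b = expA (g \<cdot>\<^bsub>N\<^esub> f) \<cdot> c \<and>
      sqM j a (pair (g \<cdot>\<^bsub>N\<^esub> f) b c) (hat (g \<cdot>\<^bsub>N\<^esub> f)) \<longrightarrow>
      chosen_solution M CF (j, \<sigma>) (on_obj \<Phi> (f, s)) a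
        (pair f (chosen_solution M CF (j, \<sigma>) (on_obj \<Phi> (g, t)) (expB f \<cdot> a) (pair g b (expA f \<cdot> c))) c) =
      chosen_solution M CF (j, \<sigma>) (on_obj \<Phi> (comp_alg N LR (g, t) (f, s))) a (pair (g \<cdot>\<^bsub>N\<^esub> f) b c))"
    (is "_ \<longleftrightarrow> (\<forall>j \<sigma> a b c. ?problem j \<sigma> a b c \<longrightarrow> ?two_step j \<sigma> a b c = ?direct j \<sigma> a b c)")
proof
  let ?h = "g \<cdot>\<^bsub>N\<^esub> f" and ?r = "LR.comp_str g t f s"
  let ?rhs = "\<theta> f s \<cdot> CF.E (CF.L (hat ?h)) (idB f) (upper_pair g t f) (hat f) \<cdot> CF.\<delta> (hat ?h)"
  note [simp] = fg_simps
  have alg_h [simp]: "is_alg N LR (?h, ?r)"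
    using LR.comp_alg_is_alg[OF alg_f alg_g composable] by (simp add: LR.comp_alg_eq)
  have two_step: "?two_step j \<sigma> a b c = ?rhs \<cdot> (CF.E j a (pair ?h b c) (hat ?h) \<cdot> \<sigma>)"
    and direct: "?direct j \<sigma> a b c = \<theta> ?h ?r \<cdot> (CF.E j a (pair ?h b c) (hat ?h) \<cdot> \<sigma>)"
    if "?problem j \<sigma> a b c" for j \<sigma> a b c
  proof -
    have "p ?h \<cdot> pair ?h b c = b" "q ?h \<cdot> pair ?h b c = c"
      using that pair_simps[of ?h b c] by (simp_all add: Hom_def)
    then show "?two_step j \<sigma> a b c = ?rhs \<cdot> (CF.E j a (pair ?h b c) (hat ?h) \<cdot> \<sigma>)"
      using that by (intro two_step_solution) simp_all
    show "?direct j \<sigma> a b c = \<theta> ?h ?r \<cdot> (CF.E j a (pair ?h b c) (hat ?h) \<cdot> \<sigma>)"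
      using that CF.coalg_simps(1-4)[of j \<sigma>]
      by (simp add: LR.comp_alg_eq chosen_solution_lift[OF alg_h])
  qed
  show "comp_compatible g t f s \<Longrightarrow> \<forall>j \<sigma> a b c. ?problem j \<sigma> a b c \<longrightarrow> ?two_step j \<sigma> a b c = ?direct j \<sigma> a b c"
    using two_step direct by (auto simp only: comp_compatible_def)
  assume solutions: "\<forall>j \<sigma> a b c. ?problem j \<sigma> a b c \<longrightarrow> ?two_step j \<sigma> a b c = ?direct j \<sigma> a b c"
  \<comment> \<open>the universal problem: the counit square of \<open>hom(i, gf)\<close>, with the cofree coalgebra as source\<close>
  let ?b = "p ?h \<cdot> CF.R (hat ?h)" and ?c = "q ?h \<cdot> CF.R (hat ?h)"
  have pair: "pair ?h ?b ?c = CF.R (hat ?h)"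
    by (rule pair_eqI) simp_all
  have sq: "sqM (CF.L (hat ?h)) (idB f) (CF.R (hat ?h)) (hat ?h)"
    using CF.sq_counit[of "hat ?h"] by simp
  have "restr (Cod N g) \<cdot> ?b = expA ?h \<cdot> ?c"
    using M.extend[OF proj_square[of ?h], of "CF.R (hat ?h)"] by simp
  then have problem: "?problem (CF.L (hat ?h)) (CF.\<delta> (hat ?h)) (idB f) ?b ?c"
    using sq pair by (simp add: CF.cofree_coalg Hom_def)
  have counit: "CF.E (CF.L (hat ?h)) (idB f) (pair ?h ?b ?c) (hat ?h) \<cdot> CF.\<delta> (hat ?h) = Ident M (CF.E0 (hat ?h))"
    using CF.comonad_laws(2)[of "hat ?h"] pair by simp
  have "?rhs = ?rhs \<cdot> (CF.E (CF.L (hat ?h)) (idB f) (pair ?h ?b ?c) (hat ?h) \<cdot> CF.\<delta> (hat ?h))"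
    unfolding counit using sq_upper_pair by simp
  also have "\<dots> = \<theta> ?h ?r \<cdot> (CF.E (CF.L (hat ?h)) (idB f) (pair ?h ?b ?c) (hat ?h) \<cdot> CF.\<delta> (hat ?h))"
    using solutions problem two_step[OF problem] direct[OF problem] by metis
  also have "\<dots> = \<theta> ?h ?r"
    unfolding counit by simp
  finally show "comp_compatible g t f s" by (simp only: comp_compatible_def)
qed

text \<open>The composite structure contains \<open>\<delta>\<^bsub>gf\<^esub>\<close>, to which the hypothesis applies. Naturality of \<open>\<rho>\<close> then
  moves the remaining factor \<open>E(1, k)\<^sup>B\<close> past \<open>\<rho>\<close>, where it turns \<open>\<rho>'\<^bsub>gf\<^esub>\<close> into \<open>d \<times> c\<close>.\<close>

lemma comp_compatible_if_comult_compatible: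
  assumes "comult_compatible (g \<cdot>\<^bsub>N\<^esub> f)"
  shows "comp_compatible g t f s"
proof -
  let ?h = "g \<cdot>\<^bsub>N\<^esub> f" and ?k = "LR.comp_lift g t f"
  note [simp] = fg_simps upper_lift_simps upper_pair_simps sq_upper_pair
  note [simp] = LR.comp_lift_simps[OF alg_f alg_g composable] LR.sq_comp_first[OF alg_f alg_g composable]
    sq_\<rho>'
  have [simp]: "sqM (hat (LR.L ?h)) (idB f) (base (LR.L ?h) (LR.id\<^sub>d f) ?k f) (hat f)"
    using sq_hat[OF LR.sq_comp_first[OF alg_f alg_g composable]] by simp
  note first [simp] = base_simps[OF LR.sq_comp_first[OF alg_f alg_g composable]]
  have expk: "expB ?k \<cdot> \<rho> ?h = upper_lift g t f"
    by (simp add: LR.comp_lift_def upper_lift_def exp_comp \<theta>_eq_\<rho>[OF alg_g] \<rho>_natural)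
  have pair: "base (LR.L ?h) (LR.id\<^sub>d f) ?k f \<cdot> \<rho>' ?h = upper_pair g t f"
    by (rule proj_joint_mono[of f])
      (simp_all add: M.extend[OF first(4)] M.extend[OF first(5)] expk)
  have "\<theta> ?h (LR.comp_str g t f s) = expB (LR.comp_str g t f s) \<cdot> \<rho> ?h"
    using LR.comp_alg_is_alg[OF alg_f alg_g composable] by (intro \<theta>_eq_\<rho>) (simp add: LR.comp_alg_eq)
  also have "\<dots> = expB s \<cdot> (expB (LR.E (LR.L ?h) (LR.id\<^sub>d f) ?k f) \<cdot> (expB (LR.\<delta> ?h) \<cdot> \<rho> ?h))"
    by (simp add: LR.comp_str_def exp_comp)
  also have "expB (LR.\<delta> ?h) \<cdot> \<rho> ?h
      = \<rho> (LR.L ?h) \<cdot> CF.E (CF.L (hat ?h)) (idB f) (\<rho>' ?h) (hat (LR.L ?h)) \<cdot> CF.\<delta> (hat ?h)"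
    using assms by (simp add: comult_compatible_def)
  also have "expB (LR.E (LR.L ?h) (LR.id\<^sub>d f) ?k f) \<cdot> \<dots>
      = \<rho> f \<cdot> (hatQ (LR.L ?h) (LR.id\<^sub>d f) ?k f \<cdot>
          (CF.E (CF.L (hat ?h)) (idB f) (\<rho>' ?h) (hat (LR.L ?h)) \<cdot> CF.\<delta> (hat ?h)))"
    using sq_\<rho>'[of ?h] \<rho>_natural[of "LR.L ?h" "LR.id\<^sub>d f" ?k f, symmetric]
    by (simp add: M.extend[of "expB (LR.E (LR.L ?h) (LR.id\<^sub>d f) ?k f)" "\<rho> (LR.L ?h)"])
  also have "hatQ (LR.L ?h) (LR.id\<^sub>d f) ?k f \<cdot>
          (CF.E (CF.L (hat ?h)) (idB f) (\<rho>' ?h) (hat (LR.L ?h)) \<cdot> CF.\<delta> (hat ?h))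
      = CF.E (CF.L (hat ?h)) (idB f) (upper_pair g t f) (hat f) \<cdot> CF.\<delta> (hat ?h)"
    using sq_\<rho>'[of ?h] sq_hat[OF LR.sq_comp_first[OF alg_f alg_g composable]]
    by (simp add: CF.E_comp_extend pair)
  finally show ?thesis
    by (simp add: comp_compatible_def \<theta>_eq_\<rho>[OF alg_f])
qed

end

text \<open>Since \<open>\<delta>\<^sub>f\<close> is an algebra map from the free algebra on \<open>f\<close> to the composite of \<open>(RLf, \<mu>\<^bsub>Lf\<^esub>)\<close> and
  \<open>(Rf, \<mu>\<^sub>f)\<close>, the lifted functor rewrites \<open>\<delta>\<^sub>f\<^sup>B \<cdot> \<rho>\<^sub>f\<close> as the structure of the image of this composite
  after the image of \<open>(LLf, 1)\<close>. Compatibility with composition expands that structure, and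
  precomposing \<open>d \<times> c\<close> with the image of \<open>(LLf, 1)\<close> gives \<open>\<rho>'\<^sub>f\<close> up to the image of the unit square
  of \<open>Lf\<close>, which is the unit square in the definition of \<open>\<rho>\<^bsub>Lf\<^esub>\<close>.\<close>

lemma comult_compatible_if_comp_compatible:
  assumes [simp]: "f \<in> Arr N"
    and compat: "comp_compatible (LR.R f) (LR.\<mu> f) (LR.R (LR.L f)) (LR.\<mu> (LR.L f))"
  shows "comult_compatible f"
proof -
  let ?g = "LR.R f" and ?k = "LR.R (LR.L f)"
  let ?h = "?g \<cdot>\<^bsub>N\<^esub> ?k" and ?r = "LR.comp_str (LR.R f) (LR.\<mu> f) (LR.R (LR.L f)) (LR.\<mu> (LR.L f))"
  let ?i = "LR.L (LR.L f)"
  have algs: "is_alg N LR (?k, LR.\<mu> (LR.L f))" "is_alg N LR (?g, LR.\<mu> f)" "Dom N ?g = Cod N ?k"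
    by (simp_all add: LR.free_alg)
  have alg_h: "is_alg N LR (?h, ?r)"
    using LR.comp_alg_is_alg[OF algs] by (simp add: LR.comp_alg_eq)
  have sqi: "sqN f ?i (LR.id\<^sub>c f) ?h" by (rule LR.comult_eq_extension) simp
  have sq2: "sqN ?h ?k (LR.id\<^sub>c f) ?g" using LR.sq_comp_second[OF algs] by simp
  have sq3: "sqN (LR.L f) ?i (Ident N (LR.E0 f)) ?k" using LR.sq_unit[of "LR.L f"] by simp
  have sq\<delta>: "sqN ?g (LR.\<delta> f) (LR.id\<^sub>c f) ?h"
    using LR.alg_map_from_free(2)[OF alg_h sqi] by (simp add: LR.comult_eq_extension)
  have squ: "sqM (CF.L (hat ?h)) (idB ?k) (upper_pair ?g (LR.\<mu> f) ?k) (hat ?k)"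
    by (rule sq_upper_pair[OF algs])
  note upper = upper_lift_simps[OF algs] upper_pair_simps[OF algs]
  note sqs = sqi sq2 sq3 sq\<delta> squ LR.sq_unit[OF assms(1)]
  note sq_hats = sq_hat[OF sqi] sq_hat[OF sq2] sq_hat[OF sq3] sq_hat[OF sq\<delta>] CF.sq_L[OF sq_hat[OF sqi]]
  note [simp] = algs(1,2) alg_h sqs sq_hats upper sq_\<rho>'
  have "expB (LR.\<delta> f) \<cdot> \<rho> f
      = (expB (LR.\<delta> f) \<cdot> \<theta> ?g (LR.\<mu> f)) \<cdot> hatQ f (LR.L f) (LR.id\<^sub>c f) ?g"
    by (simp add: \<rho>_def)
  also have "expB (LR.\<delta> f) \<cdot> \<theta> ?g (LR.\<mu> f) = \<theta> ?h ?r \<cdot> hatQ ?g (LR.\<delta> f) (LR.id\<^sub>c f) ?h"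
    using LR.alg_map_from_free(1)[OF alg_h sqi]
    by (intro lift_map[symmetric]) (simp_all add: LR.comult_eq_extension)
  also have "\<dots> \<cdot> hatQ f (LR.L f) (LR.id\<^sub>c f) ?g = \<theta> ?h ?r \<cdot> hatQ f ?i (LR.id\<^sub>c f) ?h"
    by (simp add: hatQ_comp LR.comult_L)
  also have "\<dots> = \<theta> ?k (LR.\<mu> (LR.L f)) \<cdot> (CF.E (CF.L (hat ?h)) (idB ?k) (upper_pair ?g (LR.\<mu> f) ?k) (hat ?k)
      \<cdot> (CF.\<delta> (hat ?h) \<cdot> hatQ f ?i (LR.id\<^sub>c f) ?h))"
    using compat squ by (simp add: comp_compatible_def)
  also have "CF.\<delta> (hat ?h) \<cdot> hatQ f ?i (LR.id\<^sub>c f) ?h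
      = CF.E (CF.L (hat f)) (expB ?i) (hatQ f ?i (LR.id\<^sub>c f) ?h) (CF.L (hat ?h)) \<cdot> CF.\<delta> (hat f)"
    by (rule CF.comult_natural) simp
  also have "CF.E (CF.L (hat ?h)) (idB ?k) (upper_pair ?g (LR.\<mu> f) ?k) (hat ?k) \<cdot> \<dots>
      = CF.E (CF.L (hat f)) (expB ?i) (upper_pair ?g (LR.\<mu> f) ?k \<cdot> hatQ f ?i (LR.id\<^sub>c f) ?h) (hat ?k)
        \<cdot> CF.\<delta> (hat f)"
    using squ by (simp add: CF.E_comp_extend)
  also have "upper_pair ?g (LR.\<mu> f) ?k \<cdot> hatQ f ?i (LR.id\<^sub>c f) ?h
      = base (LR.L f) ?i (Ident N (LR.E0 f)) ?k \<cdot> \<rho>' f"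
  proof (rule proj_joint_mono[of ?k])
    have "p ?k \<cdot> (upper_pair ?g (LR.\<mu> f) ?k \<cdot> hatQ f ?i (LR.id\<^sub>c f) ?h)
        = upper_lift ?g (LR.\<mu> f) ?k \<cdot> hatQ f ?i (LR.id\<^sub>c f) ?h"
      by (simp add: M.extend[OF upper_pair_simps(4)[OF algs]])
    also have "\<dots> = \<theta> ?g (LR.\<mu> f) \<cdot> (hatQ ?h ?k (LR.id\<^sub>c f) ?g \<cdot> hatQ f ?i (LR.id\<^sub>c f) ?h)"
      by (simp add: upper_lift_def)
    also have "\<dots> = \<rho> f" by (simp add: hatQ_comp \<rho>_def)
    finally show "p ?k \<cdot> (upper_pair ?g (LR.\<mu> f) ?k \<cdot> hatQ f ?i (LR.id\<^sub>c f) ?h)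
        = p ?k \<cdot> (base (LR.L f) ?i (Ident N (LR.E0 f)) ?k \<cdot> \<rho>' f)"
      using base_simps[OF sq3] by (simp add: M.extend[OF base_simps(4)[OF sq3]])
    have "q ?k \<cdot> (upper_pair ?g (LR.\<mu> f) ?k \<cdot> hatQ f ?i (LR.id\<^sub>c f) ?h)
        = q ?h \<cdot> (CF.R (hat ?h) \<cdot> hatQ f ?i (LR.id\<^sub>c f) ?h)"
      by (simp add: M.extend[OF upper_pair_simps(5)[OF algs]])
    also have "\<dots> = expA ?i \<cdot> (q f \<cdot> CF.R (hat f))"
      using base_simps[OF sqi] by (simp add: CF.R_E M.extend[OF base_simps(5)[OF sqi]])
    finally show "q ?k \<cdot> (upper_pair ?g (LR.\<mu> f) ?k \<cdot> hatQ f ?i (LR.id\<^sub>c f) ?h)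
        = q ?k \<cdot> (base (LR.L f) ?i (Ident N (LR.E0 f)) ?k \<cdot> \<rho>' f)"
      using base_simps[OF sq3] by (simp add: M.extend[OF base_simps(5)[OF sq3]])
  qed (use base_simps[OF sq3] in simp_all)
  also have "CF.E (CF.L (hat f)) (expB ?i) (base (LR.L f) ?i (Ident N (LR.E0 f)) ?k \<cdot> \<rho>' f) (hat ?k)
      = hatQ (LR.L f) ?i (Ident N (LR.E0 f)) ?k \<cdot> CF.E (CF.L (hat f)) (idB f) (\<rho>' f) (hat (LR.L f))"
    by (simp add: CF.E_comp)
  also have "\<theta> ?k (LR.\<mu> (LR.L f)) \<cdot> (\<dots> \<cdot> CF.\<delta> (hat f))
      = \<rho> (LR.L f) \<cdot> CF.E (CF.L (hat f)) (idB f) (\<rho>' f) (hat (LR.L f)) \<cdot> CF.\<delta> (hat f)"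
    using hatQ_simps[OF sq3] sq_\<rho>'[OF assms(1)] by (simp add: \<rho>_def)
  finally show ?thesis by (simp add: comult_compatible_def)
qed

lemma lax_iff_comp_compatible:
  "defines_lax_morphism K M N Hl pb i CF LR \<Phi> \<longleftrightarrow>
    (\<forall>f s g t. is_alg N LR (f, s) \<and> is_alg N LR (g, t) \<and> Dom N g = Cod N f \<longrightarrow> comp_compatible g t f s)"
proof -
  have "comult_compatible f" if "f \<in> Arr N"
    and "\<forall>f s g t. is_alg N LR (f, s) \<and> is_alg N LR (g, t) \<and> Dom N g = Cod N f \<longrightarrow> comp_compatible g t f s" for f
    using that by (intro comult_compatible_if_comp_compatible) (simp_all add: LR.free_alg)
  moreover have "comp_compatible g t f s" if "\<forall>f\<in>Arr N. comult_compatible f"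
    and "is_alg N LR (f, s)" "is_alg N LR (g, t)" "Dom N g = Cod N f" for f s g t
    using that LR.alg_simps(1) by (intro comp_compatible_if_comult_compatible) simp_all
  ultimately show ?thesis unfolding lax_iff_comult_compatible by blast
qed

end

theorem theorem5p16:
  fixes K :: "('ok, 'ak) cat" and M :: "('om, 'am) cat" and N :: "('on, 'an) cat"
    and T :: "('ok \<times> 'om, 'ak \<times> 'am, 'on, 'an) fun_data"
    and Hl :: "('ok \<times> 'on, 'ak \<times> 'an, 'om, 'am) fun_data"
    and Hr :: "('om \<times> 'on, 'am \<times> 'an, 'ok, 'ak) fun_data"
    and \<phi> :: "'ok \<Rightarrow> 'om \<Rightarrow> 'on \<Rightarrow> 'an \<Rightarrow> 'am"
    and \<psi> :: "'ok \<Rightarrow> 'om \<Rightarrow> 'on \<Rightarrow> 'am \<Rightarrow> 'ak"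
    and pb :: "'am \<Rightarrow> 'am \<Rightarrow> 'am \<times> 'am"
    and CF :: "('om, 'am) awfs_data" and LR :: "('on, 'an) awfs_data"
    and i :: 'ak and A B :: 'ok
    and \<Phi> :: "('an \<times> 'an, ('an \<times> 'an) \<times> 'an square \<times> ('an \<times> 'an),
               'am \<times> 'am, ('am \<times> 'am) \<times> 'am square \<times> ('am \<times> 'am)) fun_data"
  assumes "two_variable_adjunction K M N T Hl Hr \<phi> \<psi>"
    and "has_pullbacks K" and "has_pullbacks M" and "has_pushouts N"
    and "pullback_choice M pb"
    and "is_awfs M CF" and "is_awfs N LR"
    and "i \<in> Hom K A B"
    and "lifts_to_algs N LR M CF (hat_hom K M N Hl pb i) \<Phi>"
  shows "defines_lax_morphism K M N Hl pb i CF LR \<Phi> \<longleftrightarrow>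
    (let hat = hat_arr K M N Hl pb i;
         pair = hat_pair K M N Hl pb i
     in \<forall>X Y Z J L f s g t j \<sigma> a b c.
          is_alg N LR (f, s) \<and> f \<in> Hom N X Y \<and>
          is_alg N LR (g, t) \<and> g \<in> Hom N Y Z \<and>
          is_coalg M CF (j, \<sigma>) \<and> j \<in> Hom M J L \<and>
          a \<in> Hom M J (on_obj Hl (B, X)) \<and>
          b \<in> Hom M L (on_obj Hl (B, Z)) \<and> c \<in> Hom M L (on_obj Hl (A, X)) \<and>
          exp_restr N Hl i Z \<cdot>\<^bsub>M\<^esub> b = exp_arr K Hl A (g \<cdot>\<^bsub>N\<^esub> f) \<cdot>\<^bsub>M\<^esub> c \<and>
          Square j a (pair (g \<cdot>\<^bsub>N\<^esub> f) b c) (hat (g \<cdot>\<^bsub>N\<^esub> f)) \<in> Arr (arrow_cat M) \<longrightarrow>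
          (let d = chosen_solution M CF (j, \<sigma>) (on_obj \<Phi> (g, t))
                     (exp_arr K Hl B f \<cdot>\<^bsub>M\<^esub> a) (pair g b (exp_arr K Hl A f \<cdot>\<^bsub>M\<^esub> c));
               e = chosen_solution M CF (j, \<sigma>) (on_obj \<Phi> (f, s)) a (pair f d c)
           in e = chosen_solution M CF (j, \<sigma>) (on_obj \<Phi> (comp_alg N LR (g, t) (f, s)))
                    a (pair (g \<cdot>\<^bsub>N\<^esub> f) b c)))"
proof -
  have A: "A = Dom K i" and B: "B = Cod K i" and i: "i \<in> Arr K"
    using assms(8) by (auto simp: Hom_def)
  interpret lifted_hom K M N Hl pb i CF LR \<Phi>
    using assms i by (auto simp: lifted_hom_def lifted_hom_axioms_def pullback_hom_def
        pullback_hom_axioms_def awfs_def two_variable_adjunction_def)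
  show ?thesis
    unfolding lax_iff_comp_compatible Let_def A B
  proof (intro iffI allI impI, goal_cases)
    case (1 X Y Z J L f s g t j \<sigma> a b c)
    then have "is_alg N LR (f, s)" "is_alg N LR (g, t)" "Dom N g = Cod N f"
      by (auto simp: Hom_def)
    moreover from this have "comp_compatible g t f s" using 1(1) by blast
    ultimately show ?case
      using 1(2) comp_compatible_iff_two_step[of f s g t] by (auto simp: Hom_def)
  next
    case (2 f s g t)
    then have algs: "is_alg N LR (f, s)" "is_alg N LR (g, t)" "Dom N g = Cod N f" by auto
    have "f \<in> Arr N" "g \<in> Arr N" using algs LR.alg_simps(1) by auto
    then show ?case
      unfolding comp_compatible_iff_two_step[OF algs]
      using algs
      by (intro allI impI, intro 2(1)[rule_format, of f s "Dom N f" "Cod N f" g t "Cod N g"])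
        (auto simp: Hom_def square_arr_iff)
  qed
qed

end
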